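(* Let $N\ge2$ and consider $\mathbb{C}^{d_1}\otimes\cdots\otimes\mathbb{C}^{d_N}$ with bases $\{\mathbf{G}^{(l)}_i\}$ and constants $\kappa_l\ge1$ as in the context. Let $\{l_1,\dots,l_N\}=\{1,\dots,N\}$ with $l_1<\cdots<l_k$, $l_{k+1}<\cdots<l_N$, $l_1<l_{k+1}$, $k\in\{1,\dots,N-1\}$; put $R=(l_1,\dots,l_k)$, $C=(l_{k+1},\dots,l_N)$, and let $n\in\{1,\dots,k\}$, $m\in\{1,\dots,N-k\}$. For positive integers $p_1,p_2,q_1,q_2$ and real vectors $\bm u\in\mathbb{R}^{p_1}$, $\bm v\in\mathbb{R}^{p_2}$, $\bm\alpha\in\mathbb{R}^{q_1}$, $\bm\beta\in\mathbb{R}^{q_2}$, define for an $N$-party state $\rho$ the block matrix $$\mathcal{M}^{(l_1\cdots l_k|l_{k+1}\cdots l_N)}_{\bm u,\bm v,\bm\alpha,\bm\beta}(\rho)=\begin{pmatrix}\bm u\bm v^{\rm T} & \bm u\big(\bm\beta\otimes\mathrm{vec}_m(\mathcal{T}^{(l_{k+1}\cdots l_N)})\big)^{\rm T}\\ \big(\bm\alpha\otimes\mathrm{vec}_n(\mathcal{T}^{(l_1\cdots l_k)})\big)\bm v^{\rm T} & (\bm\alpha\bm\beta^{\rm T})\otimes\mathbf{T}^{(1\cdots N)}_{(R,n;C,m)}\end{pmatrix},$$ where $\otimes$ is the Kronecker product and $\mathbf{T}^{(1\cdots N)}_{(R,n;C,m)}$ is the mixed $(R,n;C,m)$-mode matrix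 unfolding of $\mathcal{T}^{(1\cdots N)}(\rho)$. If $\rho$ is biseparable under the bipartition $l_1\cdots l_k|l_{k+1}\cdots l_N$, then $$\big\|\mathcal{M}^{(l_1\cdots l_k|l_{k+1}\cdots l_N)}_{\bm u,\bm v,\bm\alpha,\bm\beta}(\rho)\big\|_{\rm tr}\le\sqrt{\|\bm u\|^2+\|\bm\alpha\|^2\mathfrak{m}^{(l_1\cdots l_k)}}\;\sqrt{\|\bm v\|^2+\|\bm\beta\|^2\mathfrak{m}^{(l_{k+1}\cdots l_N)}}.$$
   Context: For each $l$, $\{\mathbf{G}^{(l)}_i\}_{i=0}^{d_l^2-1}$ is a basis of complex $d_l\times d_l$ matrices with $\mathbf{G}^{(l)}_0=\mathbf{I}_{d_l}$, $\mathrm{Tr}(\mathbf{G}^{(l)}_i)=0$, $\mathrm{Tr}((\mathbf{G}^{(l)}_i)^\dagger\mathbf{G}^{(l)}_{i'})=\kappa_l\delta_{ii'}$ for $i,i'\ge1$, $\kappa_l\ge1$. For nonempty $S=\{s_1<\cdots<s_t\}\subseteq\{1,\dots,N\}$, $\mathcal{T}^{(S)}=\mathcal{T}^{(s_1\cdots s_t)}(\rho)\in\mathbb{C}^{(d_{s_1}^2-1)\times\cdots\times(d_{s_t}^2-1)}$ has entries $\prod_{s\in S}\frac{d_s}{\kappa_s}\,\mathrm{Tr}(\rho\,X_1\otimes\cdots\otimes X_N)$ with $X_s=\mathbf{G}^{(s)}_{i_s}$ ($i_s\in\{1,\dots,d_s^2-1\}$) for $s\in S$ and $X_s=\mathbf{I}_{d_s}$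 otherwise; its $j$-th mode is labelled $s_j$. Index map: $\iota_n^{(D_1,\dots,D_k)}(j_1,\dots,j_k)=(\prod_{s=1}^nD_s)\sum_{s'=n+1}^k((j_{s'}-1)\prod_{s''=s'+1}^kD_{s''})+\sum_{s'=1}^n((j_{s'}-1)\prod_{s''=s'+1}^nD_{s''})+1$ (empty products $1$, empty sums $0$). $\mathrm{vec}_n(\mathcal{A})$, for $\mathcal{A}=(a_{j_1\cdots j_k})\in\mathbb{C}^{D_1\times\cdots\times D_k}$, is the column vector with $a_{j_1\cdots j_k}$ in position $\iota_n(j_1,\dots,j_k)$. The mixed $(R,n;C,m)$-mode unfolding of a tensor with entries indexed by $(i_1,\dots,i_N)$, mode $l$ of size $D_l$, is the $(D_{l_1}\cdots D_{l_k})\times(D_{l_{k+1}}\cdots D_{l_N})$ matrix with that entry in row $\iota_n^{(D_{l_1},\dots,D_{l_k})}(i_{l_1},\dots,i_{l_k})$ and column $\iota_m^{(D_{l_{k+1}},\dots,D_{l_N})}(i_{l_{k+1}},\dots,i_{l_N})$. For $S=\{s_1<\cdots<s_t\}$ with $D=\prod_{s\in S}d_s$, $K=\prod_{s\in S}\kappa_s$, $d_S=\max_{s\in S}d_s$: $\mathfrak{m}^{(S)}=\frac{d_{s_1}^2-d_{s_1}}{\kappa_{s_1}}$ if $t=1$; $\mathfrak{m}^{(S)}=\frac{D}{K}\big(D+\frac{1}{t-1}-\frac{D}{t-1}\sum_{s\in S}\frac{1}{d_s^2}\big)$ if $t=2$, or $t\ge3$ and $D/d_S^2<1$; $\mathfrak{m}^{(S)}=\frac{D}{K}\big(D+\frac{2}{t-2}-\frac{D}{t-2}\sum_{s\in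 S}\frac{1}{d_s^2}\big)$ if $t\ge3$ and $D/d_S^2\ge1$. $\rho$ is biseparable under the bipartition $l_1\cdots l_k|l_{k+1}\cdots l_N$ if $\rho=\sum_ip_i\rho^{(l_1\cdots l_k)}_i\otimes\rho^{(l_{k+1}\cdots l_N)}_i$ with $p_i\ge0$, $\sum p_i=1$, and pure states $\rho^{(l_1\cdots l_k)}_i$, $\rho^{(l_{k+1}\cdots l_N)}_i$ on the respective groups of parties. $\|\cdot\|_{\rm tr}$ is the trace norm, $\|\cdot\|$ the Euclidean norm. *)

theory Defs
  imports "Jordan_Normal_Form.Schur_Decomposition"
begin

definition mtrace :: "complex mat \<Rightarrow> complex" where
  "mtrace A = (\<Sum>i<dim_row A. A $$ (i, i))"

text \<open>Trace norm: sum of the singular values of A, i.e. of the square roots of the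
  eigenvalues of A^dagger A counted with algebraic multiplicity.\<close>
definition trace_norm :: "complex mat \<Rightarrow> real" where
  "trace_norm A =
     (let P = char_poly (mat_adjoint A * A)
      in \<Sum>e\<in>{e. poly P e = 0}. real (order e P) * sqrt (Re e))"

definition kron :: "complex mat \<Rightarrow> complex mat \<Rightarrow> complex mat" where
  "kron A B = mat (dim_row A * dim_row B) (dim_col A * dim_col B)
     (\<lambda>(i, j). A $$ (i div dim_row B, j div dim_col B) * B $$ (i mod dim_row B, j mod dim_col B))"

definition kron_vec :: "complex vec \<Rightarrow> complex vec \<Rightarrow> complex vec" where
  "kron_vec a b = vec (dim_vec a * dim_vec b) (\<lambda>i. a $ (i div dim_vec b) * b $ (i mod dim_vec b))"

definition outer :: "complex vec \<Rightarrow> complex vec \<Rightarrow> complex mat" where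
  "outer x y = mat (dim_vec x) (dim_vec y) (\<lambda>(i, j). x $ i * y $ j)"

definition cvec :: "real vec \<Rightarrow> complex vec" where
  "cvec u = map_vec complex_of_real u"

definition vnorm :: "real vec \<Rightarrow> real" where
  "vnorm u = sqrt (\<Sum>i<dim_vec u. (u $ i)\<^sup>2)"

text \<open>Party l (1 \<le> l \<le> N) has local dimension d l. A basis index of the full space
  C^{d_1} \<otimes> ... \<otimes> C^{d_N} is decoded into local (0-based) indices, party 1 being the
  most significant digit (standard Kronecker ordering).  The same convention is used for
  a group I of parties ordered increasingly.\<close>

definition digit :: "(nat \<Rightarrow> nat) \<Rightarrow> nat set \<Rightarrow> nat \<Rightarrow> nat \<Rightarrow> nat" where
  "digit d I x l = (x div (\<Prod>l'\<in>{l'\<in>I. l < l'}. d l')) mod d l"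

definition encode :: "(nat \<Rightarrow> nat) \<Rightarrow> nat set \<Rightarrow> (nat \<Rightarrow> nat) \<Rightarrow> nat" where
  "encode d I f = (\<Sum>l\<in>I. f l * (\<Prod>l'\<in>{l'\<in>I. l < l'}. d l'))"

definition totdim :: "(nat \<Rightarrow> nat) \<Rightarrow> nat set \<Rightarrow> nat" where
  "totdim d I = (\<Prod>l\<in>I. d l)"

definition tensor_ops :: "(nat \<Rightarrow> nat) \<Rightarrow> nat \<Rightarrow> (nat \<Rightarrow> complex mat) \<Rightarrow> complex mat" where
  "tensor_ops d N X = mat (totdim d {1..N}) (totdim d {1..N})
     (\<lambda>(a, b). \<Prod>l\<in>{1..N}. X l $$ (digit d {1..N} a l, digit d {1..N} b l))"

definition pure_state :: "nat \<Rightarrow> complex mat \<Rightarrow> bool" where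
  "pure_state n \<sigma> \<longleftrightarrow> (\<exists>\<psi>. dim_vec \<psi> = n \<and> (\<Sum>i<n. (cmod (\<psi> $ i))\<^sup>2) = 1 \<and>
      \<sigma> = mat n n (\<lambda>(i, j). \<psi> $ i * cnj (\<psi> $ j)))"

text \<open>Biseparability under the bipartition A | ({1..N} - A): the product
  \<sigma>^(A) \<otimes> \<tau>^(B) is placed in the original ordering of the parties.\<close>
definition biseparable :: "(nat \<Rightarrow> nat) \<Rightarrow> nat \<Rightarrow> nat set \<Rightarrow> complex mat \<Rightarrow> bool" where
  "biseparable d N A \<rho> \<longleftrightarrow>
     (let B = {1..N} - A; D = totdim d {1..N} in
      \<exists>(r::nat) p \<sigma> \<tau>.
        (\<forall>i<r. p i \<ge> (0::real) \<and> pure_state (totdim d A) (\<sigma> i) \<and> pure_state (totdim d B) (\<tau> i)) \<and>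
        (\<Sum>i<r. p i) = 1 \<and>
        dim_row \<rho> = D \<and> dim_col \<rho> = D \<and>
        (\<forall>a<D. \<forall>b<D. \<rho> $$ (a, b) =
           (\<Sum>i<r. complex_of_real (p i) *
              \<sigma> i $$ (encode d A (digit d {1..N} a), encode d A (digit d {1..N} b)) *
              \<tau> i $$ (encode d B (digit d {1..N} a), encode d B (digit d {1..N} b)))))"

text \<open>Entry of T^(S)(\<rho>), S given as the increasing list ss = [s_1,...,s_t] of parties,
  at the (1-based) multi-index js = [i_{s_1},...,i_{s_t}].\<close>
definition corr_entry ::
  "(nat \<Rightarrow> nat) \<Rightarrow> (nat \<Rightarrow> real) \<Rightarrow> (nat \<Rightarrow> nat \<Rightarrow> complex mat) \<Rightarrow> nat \<Rightarrow> complex mat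
    \<Rightarrow> nat list \<Rightarrow> nat list \<Rightarrow> complex" where
  "corr_entry d \<kappa> G N \<rho> ss js =
     complex_of_real (\<Prod>s\<in>set ss. real (d s) / \<kappa> s) *
     mtrace (\<rho> * tensor_ops d N (\<lambda>l. case map_of (zip ss js) l of
                                       Some i \<Rightarrow> G l i | None \<Rightarrow> 1\<^sub>m (d l)))"

definition mode_sizes :: "(nat \<Rightarrow> nat) \<Rightarrow> nat list \<Rightarrow> nat list" where
  "mode_sizes d ss = map (\<lambda>s. d s ^ 2 - 1) ss"

definition iota :: "nat \<Rightarrow> nat list \<Rightarrow> nat list \<Rightarrow> nat" where
  "iota n Ds js =
     (let k = length Ds; D = (\<lambda>s. Ds ! (s - 1)); j = (\<lambda>s. js ! (s - 1)) in
      (\<Prod>s\<in>{1..n}. D s) * (\<Sum>s'\<in>{n+1..k}. (j s' - 1) * (\<Prod>s''\<in>{s'+1..k}. D s''))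
      + (\<Sum>s'\<in>{1..n}. (j s' - 1) * (\<Prod>s''\<in>{s'+1..n}. D s'')) + 1)"

definition multi_indices :: "nat list \<Rightarrow> nat list set" where
  "multi_indices Ds = {js. length js = length Ds \<and> (\<forall>j<length Ds. 1 \<le> js ! j \<and> js ! j \<le> Ds ! j)}"

definition vec_n :: "nat \<Rightarrow> nat list \<Rightarrow> (nat list \<Rightarrow> complex) \<Rightarrow> complex vec" where
  "vec_n n Ds a = vec (prod_list Ds)
     (\<lambda>p. a (THE js. js \<in> multi_indices Ds \<and> iota n Ds js = Suc p))"

definition mixed_unfold ::
  "nat list \<Rightarrow> nat list \<Rightarrow> nat \<Rightarrow> nat list \<Rightarrow> nat \<Rightarrow> (nat list \<Rightarrow> complex) \<Rightarrow> complex mat" where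
  "mixed_unfold Ds R n C m a =
     (let DR = map (\<lambda>l. Ds ! (l - 1)) R; DC = map (\<lambda>l. Ds ! (l - 1)) C in
      mat (prod_list DR) (prod_list DC)
        (\<lambda>(r, c). a (THE js. js \<in> multi_indices Ds \<and>
                            iota n DR (map (\<lambda>l. js ! (l - 1)) R) = Suc r \<and>
                            iota m DC (map (\<lambda>l. js ! (l - 1)) C) = Suc c)))"

definition mbound :: "(nat \<Rightarrow> nat) \<Rightarrow> (nat \<Rightarrow> real) \<Rightarrow> nat set \<Rightarrow> real" where
  "mbound d \<kappa> S =
     (let t = card S; D = real (\<Prod>s\<in>S. d s); K = (\<Prod>s\<in>S. \<kappa> s);
          dS = real (Max (d ` S)); \<Sigma> = (\<Sum>s\<in>S. 1 / (real (d s))\<^sup>2) in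
      if t = 1 then (let s = the_elem S in ((real (d s))\<^sup>2 - real (d s)) / \<kappa> s)
      else if t = 2 \<or> (t \<ge> 3 \<and> D / dS\<^sup>2 < 1)
        then D / K * (D + 1 / (real t - 1) - D / (real t - 1) * \<Sigma>)
      else D / K * (D + 2 / (real t - 2) - D / (real t - 2) * \<Sigma>))"

definition Mmat ::
  "(nat \<Rightarrow> nat) \<Rightarrow> (nat \<Rightarrow> real) \<Rightarrow> (nat \<Rightarrow> nat \<Rightarrow> complex mat) \<Rightarrow> nat \<Rightarrow> nat list \<Rightarrow> nat list
    \<Rightarrow> nat \<Rightarrow> nat \<Rightarrow> real vec \<Rightarrow> real vec \<Rightarrow> real vec \<Rightarrow> real vec \<Rightarrow> complex mat \<Rightarrow> complex mat" where
  "Mmat d \<kappa> G N R C n m u v \<alpha> \<beta> \<rho> =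
     (let T = corr_entry d \<kappa> G N \<rho>;
          vR = vec_n n (mode_sizes d R) (T R);
          vC = vec_n m (mode_sizes d C) (T C);
          TU = mixed_unfold (mode_sizes d [1..<N+1]) R n C m (T [1..<N+1])
      in four_block_mat
           (outer (cvec u) (cvec v)) (outer (cvec u) (kron_vec (cvec \<beta>) vC))
           (outer (kron_vec (cvec \<alpha>) vR) (cvec v)) (kron (outer (cvec \<alpha>) (cvec \<beta>)) TU))"

end

theory Submission
  imports Defs "HOL-Analysis.L2_Norm"
begin

text \<open>
  For a product of two pure states the block matrix is the rank-one matrix \<open>x y\<^sup>T\<close>, where \<open>x\<close> stacks \<open>u\<close> on
  \<open>\<alpha> \<otimes> vec T\<^sup>R\<close> and \<open>y\<close> stacks \<open>v\<close> on \<open>\<beta> \<otimes> vec T\<^sup>C\<close>. The block matrix is affine in the state, so the trace norm of a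
  mixture is at most the average of the products of the Euclidean norms.

  It remains to bound the norm of the full correlation tensor of a pure state on a set \<open>S\<close> of parties.
  Let \<open>c A\<close> be the suitably weighted squared norm of the correlations supported exactly on \<open>A\<close>.
  Completeness of the operator bases gives \<open>\<Sum>\<^sub>A\<^sub>\<subseteq>\<^sub>B c A = D\<^sub>B Tr \<rho>\<^sub>B\<^sup>2\<close>, with \<open>D\<^sub>B\<close> the dimension of the parties in \<open>B\<close>.
  For a pure state the purities of complementary sets of parties agree; comparing each \<open>{s}\<close> with \<open>S - {s}\<close> yields linear
  relations between the \<open>c A\<close>, which bound \<open>c S\<close> because all \<open>c A\<close> are nonnegative.
\<close>

section \<open>Diagonalization of Hermitian matrices\<close>

text \<open>\<open>trace_norm\<close> is defined through roots of a characteristic polynomial, which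
  hides its convexity. Hence the spectral theorem below: the singular vectors of the whole mixture
  are fixed, and each rank-one term is then tested against them. The weights bring every
  \<open>G s i\<close> to the squared norm \<open>d s\<close> that the identity has anyway. A tensor
  entry carries the factor \<open>d s / \<kappa> s\<close> for each party; squaring it gives one
  such factor more than the weight absorbs, which is the prefactor \<open>D / K\<close> of
  \<open>mbound\<close>. For a party s the comparison of purities reads: the sum of c A over subsets
  A of S - {s} is (D / d_s^2) (1 + c {s}). Summed over s and combined with the total D of all c A,
  it gives every A the coefficient card A - z. For z = 1 only the empty set has a negative
  coefficient, -1; this yields the numerator 1 and the denominator t - 1. For z = 2 the empty set
  has -2 and each singleton -1; the singletons are absorbed by (D / d_s^2) c {s} when D / d_s^2 is
  at least 1. Hence the case distinction in \<open>mbound\<close>, decided by the largest local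
  dimension.\<close>

lemma mat_adjoint_carrier [simp]: "A \<in> carrier_mat n m \<Longrightarrow> mat_adjoint A \<in> carrier_mat m n"
  by (auto simp: mat_adjoint_def)

lemma dim_mat_adjoint [simp]: "dim_row (mat_adjoint A) = dim_col A" "dim_col (mat_adjoint A) = dim_row A"
  by (auto simp: mat_adjoint_def)

lemma index_mat_adjoint [simp]:
  "i < dim_col A \<Longrightarrow> j < dim_row A \<Longrightarrow> mat_adjoint A $$ (i, j) = conjugate (A $$ (j, i))"
  by (auto simp: mat_adjoint_def mat_of_rows_index)

lemma mat_adjoint_mult:
  fixes A B :: "complex mat"
  assumes "A \<in> carrier_mat n m" "B \<in> carrier_mat m k"
  shows "mat_adjoint (A * B) = mat_adjoint B * mat_adjoint A"
  by (rule eq_matI) (use assms in \<open>auto simp: scalar_prod_def mult.commute intro!: sum.cong\<close>)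

lemma mat_adjoint_adjoint [simp]: "mat_adjoint (mat_adjoint (A :: complex mat)) = A"
  by (rule eq_matI) auto

lemma index_adjoint_mult:
  fixes A B :: "complex mat"
  assumes "A \<in> carrier_mat a b" "B \<in> carrier_mat a c" "i < b" "j < c"
  shows "(mat_adjoint A * B) $$ (i, j) = (\<Sum>k<a. cnj (A $$ (k, i)) * B $$ (k, j))"
  using assms by (auto simp: scalar_prod_def atLeast0LessThan intro!: sum.cong)

lemma mat_adjoint_four_block_diag:
  fixes A B :: "complex mat"
  assumes "A \<in> carrier_mat n n" "B \<in> carrier_mat m m"
  shows "mat_adjoint (four_block_mat A (0\<^sub>m n m) (0\<^sub>m m n) B) =
    four_block_mat (mat_adjoint A) (0\<^sub>m n m) (0\<^sub>m m n) (mat_adjoint B)"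
  by (rule eq_matI) (use assms in \<open>auto simp: Let_def\<close>)

lemma four_block_diag_mult:
  fixes A B C D :: "complex mat"
  assumes "A \<in> carrier_mat n n" "B \<in> carrier_mat m m" "C \<in> carrier_mat n n" "D \<in> carrier_mat m m"
  shows "four_block_mat A (0\<^sub>m n m) (0\<^sub>m m n) B * four_block_mat C (0\<^sub>m n m) (0\<^sub>m m n) D =
    four_block_mat (A * C) (0\<^sub>m n m) (0\<^sub>m m n) (B * D)"
  by (subst mult_four_block_mat[of _ n n _ m _ m _ _ n _ m]) (use assms in auto)

text \<open>Gram-Schmidt keeps the first vector of a basis completing \<open>v\<close> and produces
  orthogonal but unnormalized vectors. Normalizing them costs only the scalar \<open>c\<close> on
  \<open>v\<close>.\<close>

lemma unitary_with_first_column: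
  fixes v :: "complex vec"
  assumes v: "v \<in> carrier_vec n" and v0: "v \<noteq> 0\<^sub>v n" and n: "n \<noteq> 0"
  shows "\<exists>W c. W \<in> carrier_mat n n \<and> mat_adjoint W * W = 1\<^sub>m n \<and> col W 0 = c \<cdot>\<^sub>v v"
proof -
  interpret cof_vec_space n "TYPE(complex)" .
  define b where "b = basis_completion v"
  define ws where "ws = gram_schmidt n b"
  from basis_completion[OF v v0, folded b_def]
  have dist_b: "distinct b" and indep: "\<not> lin_dep (set b)" and b: "set b \<subseteq> carrier_vec n"
    and hdb: "hd b = v" and len_b: "length b = n" by auto
  from hdb len_b n obtain vs where bv: "b = v # vs" by (cases b) auto
  from gram_schmidt_result[OF b dist_b indep refl, folded ws_def]
  have ws: "set ws \<subseteq> carrier_vec n" "corthogonal ws" "length ws = n"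
    by (auto simp: len_b)
  have hdws: "hd ws = v" using gram_schmidt_hd[OF v, of vs, folded bv] unfolding ws_def .
  have wsc: "ws ! j \<in> carrier_vec n" if "j < n" for j using ws that by auto
  define r where "r j = complex_of_real (1 / sqrt (\<Sum>i<n. (cmod (ws ! j $ i))\<^sup>2))" for j
  define W where "W = mat n n (\<lambda>(i, j). r j * ws ! j $ i)"
  have W: "W \<in> carrier_mat n n" by (simp add: W_def)
  have sp: "(\<Sum>i<n. ws ! j $ i * cnj (ws ! k $ i)) = ws ! j \<bullet>c ws ! k" if "j < n" "k < n" for j k
  proof -
    have "dim_vec (ws ! j) = n" "dim_vec (ws ! k) = n" using wsc that by auto
    thus ?thesis by (simp add: scalar_prod_def atLeast0LessThan)
  qed
  have nrm: "ws ! j \<bullet>c ws ! j = of_real (\<Sum>i<n. (cmod (ws ! j $ i))\<^sup>2)" if "j < n" for j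
    by (simp only: of_real_sum complex_norm_square sp[OF that that])
  have nz: "(\<Sum>i<n. (cmod (ws ! j $ i))\<^sup>2) > 0" if "j < n" for j
  proof -
    have "ws ! j \<bullet>c ws ! j \<noteq> 0" using corthogonalD[OF ws(2), of j j] that ws(3) by auto
    hence "(\<Sum>i<n. (cmod (ws ! j $ i))\<^sup>2) \<noteq> 0" unfolding nrm[OF that] of_real_eq_0_iff .
    thus ?thesis by (simp add: order_less_le sum_nonneg)
  qed
  have "mat_adjoint W * W = 1\<^sub>m n"
  proof (rule eq_matI)
    fix i j assume "i < dim_row (1\<^sub>m n :: complex mat)" "j < dim_col (1\<^sub>m n :: complex mat)"
    hence i: "i < n" and j: "j < n" by auto
    have "(mat_adjoint W * W) $$ (i, j) = (\<Sum>k<n. cnj (W $$ (k, i)) * W $$ (k, j))"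
      by (rule index_adjoint_mult[OF W W i j])
    also have "\<dots> = (\<Sum>k<n. r i * r j * (ws ! j $ k * cnj (ws ! i $ k)))"
      by (rule sum.cong) (use i j in \<open>auto simp: W_def r_def\<close>)
    also have "\<dots> = r i * r j * (ws ! j \<bullet>c ws ! i)"
      by (simp add: sum_distrib_left[symmetric] sp[OF j i])
    also have "\<dots> = (if i = j then 1 else 0)"
    proof (cases "i = j")
      case True
      define q where "q = (\<Sum>i<n. (cmod (ws ! j $ i))\<^sup>2)"
      have q: "q > 0" using nz[OF j] by (simp add: q_def)
      have "1 / sqrt q * (1 / sqrt q) * q = 1" using q by (simp add: field_simps)
      hence "complex_of_real (1 / sqrt q) * complex_of_real (1 / sqrt q) * complex_of_real q = 1"
        by (metis of_real_1 of_real_mult)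
      thus ?thesis using True nrm[OF j] by (simp add: r_def q_def)
    next
      case False
      thus ?thesis using corthogonalD[OF ws(2), of j i] i j ws(3) by auto
    qed
    finally show "(mat_adjoint W * W) $$ (i, j) = 1\<^sub>m n $$ (i, j)" using i j by simp
  qed (use W in auto)
  moreover have "ws ! 0 = v" using hdws ws(3) n by (cases ws) auto
  hence "col W 0 = r 0 \<cdot>\<^sub>v v"
    by (intro eq_vecI) (use n v in \<open>auto simp: W_def\<close>)
  ultimately show ?thesis using W by blast
qed

text \<open>Deflation by one eigenvector at a time. The diagonal is the prescribed list
  \<open>es\<close>, so that every root appears with the algebraic multiplicity that
  \<open>trace_norm\<close> counts.\<close>

theorem hermitian_unitary_diagonalization:
  fixes H :: "complex mat"
  assumes "H \<in> carrier_mat n n" "mat_adjoint H = H" "char_poly H = (\<Prod>e\<leftarrow>es. [:- e, 1:])"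
  shows "\<exists>U. U \<in> carrier_mat n n \<and> mat_adjoint U * U = 1\<^sub>m n \<and> length es = n \<and>
    mat_adjoint U * H * U = mat n n (\<lambda>(i, j). if i = j then es ! i else 0)"
  using assms
proof (induction es arbitrary: n H)
  case Nil
  have n: "n = 0" using degree_monic_char_poly[OF Nil(1)] Nil(3) by auto
  show ?case by (rule exI[of _ "1\<^sub>m 0"]) (use n Nil in auto)
next
  case (Cons e es n H)
  note H = Cons.prems(1)
  let ?n1 = "n - 1"
  have cp: "char_poly H = [: -e, 1 :] * (\<Prod>e \<leftarrow> es. [:- e, 1:])" using Cons.prems(3) by auto
  have mon: "monic (\<Prod>e\<leftarrow> es. [:- e, 1:])" by (rule monic_prod_list) auto
  have "degree (char_poly H) = Suc (degree (\<Prod>e\<leftarrow> es. [:- e, 1:]))" unfolding cp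
    by (subst degree_mult_eq) (use mon in auto)
  with degree_monic_char_poly[OF H] have n: "n \<noteq> 0" by auto
  have n1: "Suc (n - Suc 0) = n" using n by simp
  have "eigenvalue H e" unfolding eigenvalue_root_char_poly[OF H] cp by simp
  then obtain v where v: "v \<in> carrier_vec n" "v \<noteq> 0\<^sub>v n" and ev: "H *\<^sub>v v = e \<cdot>\<^sub>v v"
    using H unfolding eigenvalue_def eigenvector_def by auto
  obtain W c where W: "W \<in> carrier_mat n n" and WW: "mat_adjoint W * W = 1\<^sub>m n"
    and colW: "col W 0 = c \<cdot>\<^sub>v v" using unitary_with_first_column[OF v n] by blast
  have W': "mat_adjoint W \<in> carrier_mat n n" using W by simp
  have WW': "W * mat_adjoint W = 1\<^sub>m n" using mat_mult_left_right_inverse[OF W' W WW] .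
  define K where "K = mat_adjoint W * H * W"
  have K: "K \<in> carrier_mat n n" using W H W' by (auto simp: K_def)
  have Kadj: "mat_adjoint K = K"
    unfolding K_def using H W W' Cons.prems(2)
    by (simp add: mat_adjoint_mult[of _ n n _ n] assoc_mult_mat[of _ n n _ n _ n] mult_carrier_mat[of _ n n _ n])
  \<comment> \<open>Similarity preserves the characteristic polynomial; cancelling the factor of
    \<open>e\<close> below leaves the block \<open>L\<close> with exactly the roots
    \<open>es\<close>.\<close>
  have sim: "similar_mat K H"
    unfolding similar_mat_def similar_mat_wit_def Let_def
    by (rule exI[of _ "mat_adjoint W"], rule exI[of _ W]) (use W W' H WW WW' K in \<open>auto simp: K_def\<close>)
  have "col K 0 = mat_adjoint W *\<^sub>v (H *\<^sub>v col W 0)"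
  proof -
    have "col K 0 = (mat_adjoint W * H) *\<^sub>v col W 0" unfolding K_def
      using n W by (intro col_mult2[of _ n n _ n]) (use H W W' n in auto)
    thus ?thesis using W W' H n by (simp add: assoc_mult_mat_vec[of _ n n _ n])
  qed
  also have "H *\<^sub>v col W 0 = e \<cdot>\<^sub>v col W 0"
    unfolding colW using H v ev by (simp add: mult_mat_vec smult_smult_assoc mult.commute)
  also have "mat_adjoint W *\<^sub>v (e \<cdot>\<^sub>v col W 0) = e \<cdot>\<^sub>v (mat_adjoint W *\<^sub>v col W 0)"
    using W W' n by (intro mult_mat_vec[of _ n n]) auto
  also have "mat_adjoint W *\<^sub>v col W 0 = col (mat_adjoint W * W) 0"
    using W W' n by (intro col_mult2[symmetric, of _ n n _ n]) auto
  also have "\<dots> = unit_vec n 0" unfolding WW using n by auto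
  finally have col0: "col K 0 = e \<cdot>\<^sub>v unit_vec n 0" .
  have Kc: "K $$ (i, 0) = (if i = 0 then e else 0)" if "i < n" for i
    using arg_cong[OF col0, of "\<lambda>w. w $ i"] that K n by (auto simp: unit_vec_def)
  \<comment> \<open>Since \<open>K\<close> is Hermitian, its first row vanishes along with its first
    column, so \<open>K\<close> is block diagonal and not merely block triangular.\<close>
  have Kr: "K $$ (0, i) = (if i = 0 then e else 0)" if "i < n" for i
  proof (cases "i = 0")
    case False
    have "K $$ (0, i) = cnj (K $$ (i, 0))"
      using arg_cong[OF Kadj, of "\<lambda>M. M $$ (0, i)"] that n K by simp
    thus ?thesis using Kc[OF that] False by simp
  qed (use Kc n in auto)
  define L where "L = mat ?n1 ?n1 (\<lambda>(i, j). K $$ (Suc i, Suc j))"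
  have L: "L \<in> carrier_mat ?n1 ?n1" by (simp add: L_def)
  let ?E = "mat 1 1 (\<lambda>_. e)"
  have Kblock: "K = four_block_mat ?E (0\<^sub>m 1 ?n1) (0\<^sub>m ?n1 1) L"
    by (rule eq_matI) (use K n Kc Kr in \<open>auto simp: L_def Let_def\<close>)
  have "mat_adjoint L = L"
  proof (rule eq_matI)
    fix i j assume "i < dim_row L" "j < dim_col L"
    thus "mat_adjoint L $$ (i, j) = L $$ (i, j)"
      using arg_cong[OF Kadj, of "\<lambda>M. M $$ (Suc i, Suc j)"] K n by (auto simp: L_def)
  qed (auto simp: L_def)
  moreover have "char_poly L = (\<Prod>e\<leftarrow>es. [:- e, 1:])"
  proof -
    have "char_poly K = char_poly ?E * char_poly L" unfolding Kblock
      by (rule char_poly_four_block_zeros_col) (use L in auto)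
    moreover have "char_poly ?E = [: -e, 1 :]" by (simp add: char_poly_defs det_def sign_def)
    ultimately have "[: -e, 1 :] * char_poly L = [: -e, 1 :] * (\<Prod>e \<leftarrow> es. [:- e, 1:])"
      using char_poly_similar[OF sim] cp by simp
    thus ?thesis by (metis mult_cancel_left pCons_eq_0_iff zero_neq_one)
  qed
  ultimately obtain U where U: "U \<in> carrier_mat ?n1 ?n1" and UU: "mat_adjoint U * U = 1\<^sub>m ?n1"
    and len: "length es = ?n1"
    and diag: "mat_adjoint U * L * U = mat ?n1 ?n1 (\<lambda>(i, j). if i = j then es ! i else 0)"
    using Cons.IH[OF L] by blast
  define F where "F = four_block_mat (1\<^sub>m 1) (0\<^sub>m 1 ?n1) (0\<^sub>m ?n1 1) U"
  have F: "F \<in> carrier_mat n n" using four_block_carrier_mat[OF one_carrier_mat[of 1] U] n by (simp add: F_def)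
  have F'b: "mat_adjoint F = four_block_mat (1\<^sub>m 1) (0\<^sub>m 1 ?n1) (0\<^sub>m ?n1 1) (mat_adjoint U)"
  proof -
    have "mat_adjoint (1\<^sub>m 1 :: complex mat) = 1\<^sub>m 1" by (rule eq_matI) auto
    thus ?thesis unfolding F_def using mat_adjoint_four_block_diag[OF one_carrier_mat[of 1] U] by simp
  qed
  have F': "mat_adjoint F \<in> carrier_mat n n" using F by simp
  have WF: "mat_adjoint (W * F) = mat_adjoint F * mat_adjoint W" using mat_adjoint_mult[OF W F] .
  have U': "mat_adjoint U \<in> carrier_mat ?n1 ?n1" using U by simp
  have FF: "mat_adjoint F * F = 1\<^sub>m n"
    unfolding F'b unfolding F_def using four_block_diag_mult[OF one_carrier_mat[of 1] U' one_carrier_mat[of 1] U]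
    by (simp add: UU n1)
  have "mat_adjoint (W * F) * (W * F) = mat_adjoint F * (mat_adjoint W * W) * F"
    unfolding WF using W F W' F' by (simp add: assoc_mult_mat[of _ n n _ n _ n] mult_carrier_mat[of _ n n _ n])
  hence 1: "mat_adjoint (W * F) * (W * F) = 1\<^sub>m n" using WW FF F F' by simp
  have "mat_adjoint (W * F) * H * (W * F) = mat_adjoint F * K * F"
    unfolding WF K_def using W F W' F' H by (simp add: assoc_mult_mat[of _ n n _ n _ n] mult_carrier_mat[of _ n n _ n])
  also have "\<dots> = four_block_mat ?E (0\<^sub>m 1 ?n1) (0\<^sub>m ?n1 1) (mat_adjoint U * L * U)"
    unfolding F'b Kblock unfolding F_def
    using four_block_diag_mult[OF one_carrier_mat[of 1] U' _ L, of ?E]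
      four_block_diag_mult[OF _ _ one_carrier_mat[of 1] U, of ?E "mat_adjoint U * L"] U' L U
    by (simp add: assoc_mult_mat[OF U' L U])
  also have "\<dots> = mat n n (\<lambda>(i, j). if i = j then (e # es) ! i else 0)"
    unfolding diag by (rule eq_matI) (use n in \<open>auto simp: Let_def nth_Cons'\<close>)
  finally have 2: "mat_adjoint (W * F) * H * (W * F) = mat n n (\<lambda>(i, j). if i = j then (e # es) ! i else 0)" .
  have "W * F \<in> carrier_mat n n" using W F by simp
  thus ?case using 1 2 len n by (intro exI[of _ "W * F"]) auto
qed

section \<open>The trace norm\<close>

lemma order_prod_list_linear:
  fixes es :: "'a :: field list"
  shows "order a (\<Prod>e\<leftarrow>es. [:- e, 1:]) = count_list es a"
proof (induction es)
  case (Cons e es)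
  have "[:- e, 1:] * (\<Prod>e\<leftarrow>es. [:- e, 1:]) \<noteq> 0"
    unfolding mult_eq_0_iff by (auto simp: prod_list_zero_iff)
  from order_mult[OF this, of a] show ?case using Cons
    by (simp add: order_linear' del: mult_pCons_left)
qed auto

lemma sum_count_list:
  fixes g :: "'a \<Rightarrow> real"
  assumes "set es \<subseteq> X" "finite X"
  shows "(\<Sum>e\<in>X. real (count_list es e) * g e) = sum_list (map g es)"
  using assms(1)
proof (induction es)
  case (Cons a es)
  have "(\<Sum>e\<in>X. real (count_list (a # es) e) * g e) =
      (\<Sum>e\<in>X. (if e = a then g e else 0) + real (count_list es e) * g e)"
    by (intro sum.cong refl) (auto simp: algebra_simps)
  thus ?case using Cons assms(2) by (simp add: sum.distrib)
qed auto

text \<open>Bridge between the definition of \<open>trace_norm\<close>, which runs over distinct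
  roots, and a diagonalization, which lists them with repetition.\<close>

lemma sum_over_roots_linear:
  fixes es :: "'a :: field list" and g :: "'a \<Rightarrow> real"
  shows "(\<Sum>e\<in>{e. poly (\<Prod>e\<leftarrow>es. [:- e, 1:]) e = 0}. real (order e (\<Prod>e\<leftarrow>es. [:- e, 1:])) * g e)
    = (\<Sum>i<length es. g (es ! i))"
proof -
  have "{e. poly (\<Prod>e\<leftarrow>es. [:- e, 1:]) e = 0} = set es"
    by (auto simp: poly_prod_list prod_list_zero_iff)
  thus ?thesis
    by (simp add: order_prod_list_linear sum_count_list sum_list_sum_nth atLeast0LessThan)
qed

lemma Bessel_inequality:
  fixes W :: "nat \<Rightarrow> nat \<Rightarrow> complex"
  assumes orth: "\<And>j k. j < b \<Longrightarrow> k < b \<Longrightarrow>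
      (\<Sum>i<a. cnj (W i j) * W i k) = (if j = k then complex_of_real (\<nu> j) else 0)"
    and le1: "\<And>j. j < b \<Longrightarrow> \<nu> j \<le> 1"
  shows "(\<Sum>j<b. (cmod (\<Sum>i<a. cnj (W i j) * x i))\<^sup>2) \<le> (\<Sum>i<a. (cmod (x i))\<^sup>2)"
proof -
  define c where "c j = (\<Sum>i<a. cnj (W i j) * x i)" for j
  let ?R = "\<lambda>i. \<Sum>j<b. c j * W i j"
  have cross: "(\<Sum>i<a. cnj (?R i) * x i) = (\<Sum>j<b. cnj (c j) * c j)"
  proof -
    have "(\<Sum>i<a. cnj (?R i) * x i) = (\<Sum>i<a. \<Sum>j<b. cnj (c j) * (cnj (W i j) * x i))"
      by (simp add: sum_distrib_right mult.assoc)
    also have "\<dots> = (\<Sum>j<b. \<Sum>i<a. cnj (c j) * (cnj (W i j) * x i))" by (rule sum.swap)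
    also have "\<dots> = (\<Sum>j<b. cnj (c j) * c j)" by (simp add: c_def sum_distrib_left)
    finally show ?thesis .
  qed
  have cross': "(\<Sum>i<a. cnj (x i) * ?R i) = (\<Sum>j<b. cnj (c j) * c j)"
    using arg_cong[OF cross, of cnj] by (simp add: mult.commute)
  have quad: "(\<Sum>i<a. cnj (?R i) * ?R i) = (\<Sum>j<b. cnj (c j) * c j * of_real (\<nu> j))"
  proof -
    have "(\<Sum>i<a. cnj (?R i) * ?R i) = (\<Sum>i<a. \<Sum>j<b. \<Sum>k<b. cnj (c j) * c k * (cnj (W i j) * W i k))"
      unfolding cnj_sum complex_cnj_mult sum_product by (intro sum.cong refl) (simp only: mult_ac)
    also have "\<dots> = (\<Sum>j<b. \<Sum>i<a. \<Sum>k<b. cnj (c j) * c k * (cnj (W i j) * W i k))" by (rule sum.swap)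
    also have "\<dots> = (\<Sum>j<b. \<Sum>k<b. \<Sum>i<a. cnj (c j) * c k * (cnj (W i j) * W i k))"
      by (rule sum.cong[OF refl], rule sum.swap)
    also have "\<dots> = (\<Sum>j<b. \<Sum>k<b. cnj (c j) * c k * (if j = k then of_real (\<nu> j) else 0))"
      unfolding sum_distrib_left[symmetric] using orth by (intro sum.cong refl) auto
    also have "\<dots> = (\<Sum>j<b. cnj (c j) * c j * of_real (\<nu> j))"
      by (intro sum.cong refl) (simp add: if_distrib[of "\<lambda>z. _ * z"] cong: if_cong)
    finally show ?thesis .
  qed
  have sq: "cnj z * z = of_real ((cmod z)\<^sup>2)" for z
    by (simp only: complex_norm_square mult.commute)
  have "of_real (\<Sum>i<a. (cmod (x i - ?R i))\<^sup>2) = (\<Sum>i<a. cnj (x i - ?R i) * (x i - ?R i))"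
    unfolding sq by simp
  also have "\<dots> = (\<Sum>i<a. cnj (x i) * x i) - (\<Sum>i<a. cnj (x i) * ?R i) - (\<Sum>i<a. cnj (?R i) * x i)
      + (\<Sum>i<a. cnj (?R i) * ?R i)"
    unfolding sum_subtractf[symmetric] sum.distrib[symmetric]
    by (intro sum.cong refl) (simp only: complex_cnj_diff algebra_simps)
  also have "\<dots> = of_real ((\<Sum>i<a. (cmod (x i))\<^sup>2) - (\<Sum>j<b. (cmod (c j))\<^sup>2) - (\<Sum>j<b. (cmod (c j))\<^sup>2)
      + (\<Sum>j<b. (cmod (c j))\<^sup>2 * \<nu> j))"
    unfolding cross cross' quad unfolding sq by simp
  finally have "(\<Sum>i<a. (cmod (x i - ?R i))\<^sup>2) = (\<Sum>i<a. (cmod (x i))\<^sup>2) - (\<Sum>j<b. (cmod (c j))\<^sup>2)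
      - (\<Sum>j<b. (cmod (c j))\<^sup>2) + (\<Sum>j<b. (cmod (c j))\<^sup>2 * \<nu> j)"
    unfolding of_real_eq_iff .
  moreover have "0 \<le> (\<Sum>i<a. (cmod (x i - ?R i))\<^sup>2)" by (simp add: sum_nonneg)
  moreover have "(\<Sum>j<b. (cmod (c j))\<^sup>2 * \<nu> j) \<le> (\<Sum>j<b. (cmod (c j))\<^sup>2)"
    by (intro sum_mono) (use le1 in \<open>auto simp: mult_left_le\<close>)
  ultimately show ?thesis unfolding c_def[symmetric] by linarith
qed

lemma cmod_sum_mult_le:
  "cmod (\<Sum>j<b. f j * g j) \<le> sqrt (\<Sum>j<b. (cmod (f j))\<^sup>2) * sqrt (\<Sum>j<b. (cmod (g j))\<^sup>2)"
proof -
  have "cmod (\<Sum>j<b. f j * g j) \<le> (\<Sum>j<b. \<bar>cmod (f j)\<bar> * \<bar>cmod (g j)\<bar>)"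
    using norm_sum[of "\<lambda>j. f j * g j" "{..<b}"] by (simp add: norm_mult)
  also have "\<dots> \<le> L2_set (\<lambda>j. cmod (f j)) {..<b} * L2_set (\<lambda>j. cmod (g j)) {..<b}"
    by (rule L2_set_mult_ineq)
  finally show ?thesis by (simp add: L2_set_def)
qed

text \<open>The singular value decomposition writes the trace norm as \<open>\<Sum>\<^sub>j \<langle>w\<^sub>j, A v\<^sub>j\<rangle>\<close> with orthonormal
  systems \<open>v\<close> and \<open>w\<close>, which is linear in \<open>A\<close> once \<open>v\<close> and \<open>w\<close> are fixed.\<close>
theorem trace_norm_rank_one_sum_le:
  assumes A: "A \<in> carrier_mat a b"
    and entries: "\<And>i j. i < a \<Longrightarrow> j < b \<Longrightarrow> A $$ (i, j) = (\<Sum>k<r. of_real (p k) * x k i * y k j)"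
    and p: "\<And>k. k < r \<Longrightarrow> p k \<ge> 0"
  shows "trace_norm A \<le>
    (\<Sum>k<r. p k * (sqrt (\<Sum>i<a. (cmod (x k i))\<^sup>2) * sqrt (\<Sum>j<b. (cmod (y k j))\<^sup>2)))"
proof -
  have A': "mat_adjoint A \<in> carrier_mat b a" using A by simp
  define H where "H = mat_adjoint A * A"
  have H: "H \<in> carrier_mat b b" using A A' by (auto simp: H_def)
  have Hadj: "mat_adjoint H = H" unfolding H_def using mat_adjoint_mult[OF A' A] by simp
  obtain es where es: "char_poly H = (\<Prod>e\<leftarrow>es. [:- e, 1:])" using char_poly_factorized[OF H] by blast
  obtain U where U: "U \<in> carrier_mat b b" and UU: "mat_adjoint U * U = 1\<^sub>m b" and len: "length es = b"
    and diag: "mat_adjoint U * H * U = mat b b (\<lambda>(i, j). if i = j then es ! i else 0)"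
    using hermitian_unitary_diagonalization[OF H Hadj es] by blast
  have tn: "trace_norm A = (\<Sum>j<b. sqrt (Re (es ! j)))"
    unfolding trace_norm_def H_def[symmetric] es Let_def sum_over_roots_linear len ..
  \<comment> \<open>The columns of \<open>U\<close> are right singular vectors: \<open>A\<close>
    maps them to mutually orthogonal columns whose squared norms are the eigenvalues of
    \<open>H\<close>.\<close>
  define B where "B = A * U"
  have B: "B \<in> carrier_mat a b" using A U by (simp add: B_def)
  have U': "mat_adjoint U \<in> carrier_mat b b" using U by simp
  have "mat_adjoint B * B = mat_adjoint U * H * U"
    unfolding B_def H_def mat_adjoint_mult[OF A U] using A U A' U'
    by (simp add: assoc_mult_mat[of _ b b _ b _ b] assoc_mult_mat[of _ b b _ a _ b]
        assoc_mult_mat[of _ b a _ b _ b] mult_carrier_mat[of _ b a _ b] mult_carrier_mat[of _ a b _ b])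
  hence orthB: "(\<Sum>i<a. cnj (B $$ (i, j)) * B $$ (i, k)) = (if j = k then es ! j else 0)"
    if "j < b" "k < b" for j k
    using index_adjoint_mult[OF B B that] that unfolding diag by simp
  have orthU: "(\<Sum>i<b. cnj (U $$ (i, j)) * U $$ (i, k)) = (if j = k then 1 else 0)"
    if "j < b" "k < b" for j k
    using index_adjoint_mult[OF U U that] that unfolding UU by simp
  define s where "s j = (\<Sum>i<a. (cmod (B $$ (i, j)))\<^sup>2)" for j
  have sq: "cnj z * z = of_real ((cmod z)\<^sup>2)" for z
    by (simp only: complex_norm_square mult.commute)
  have es_s: "es ! j = of_real (s j)" if "j < b" for j
    using orthB[OF that that] unfolding sq s_def by simp
  have s0: "s j \<ge> 0" for j unfolding s_def by (simp add: sum_nonneg)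
  \<comment> \<open>For \<open>s j = 0\<close> division by zero makes the column zero instead of a
    unit vector; its squared norm, written \<open>s j / (sqrt (s j) * sqrt (s j))\<close>, is then
    0, so it is at most 1 in every case.\<close>
  define W where "W i j = B $$ (i, j) / of_real (sqrt (s j))" for i j
  have orthW: "(\<Sum>i<a. cnj (W i j) * W i k) = (if j = k then of_real (s j / (sqrt (s j) * sqrt (s j))) else 0)"
    if "j < b" "k < b" for j k
  proof -
    have "(\<Sum>i<a. cnj (W i j) * W i k) = (\<Sum>i<a. cnj (B $$ (i, j)) * B $$ (i, k)) / of_real (sqrt (s j) * sqrt (s k))"
      unfolding W_def sum_divide_distrib by (intro sum.cong refl) simp
    thus ?thesis unfolding orthB[OF that] using es_s[OF that(1)] by (cases "j = k") (simp_all only: if_True if_False of_real_divide div_0 refl)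
  qed
  have W1: "s j / (sqrt (s j) * sqrt (s j)) \<le> 1" for j using s0[of j] by simp
  have root: "of_real (sqrt (s j)) = (\<Sum>i<a. cnj (W i j) * B $$ (i, j))" if "j < b" for j
  proof -
    have "(\<Sum>i<a. cnj (W i j) * B $$ (i, j)) = (\<Sum>i<a. cnj (B $$ (i, j)) * B $$ (i, j)) / of_real (sqrt (s j))"
      unfolding W_def sum_divide_distrib by (intro sum.cong refl) simp
    also have "\<dots> = of_real (s j / sqrt (s j))"
      using orthB[OF that that] es_s[OF that] by simp
    also have "s j / sqrt (s j) = sqrt (s j)" using s0[of j] by (simp add: real_div_sqrt)
    finally show ?thesis by simp
  qed
  have Bent: "B $$ (i, j) = (\<Sum>k<r. of_real (p k) * x k i * (\<Sum>l<b. y k l * U $$ (l, j)))"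
    if "i < a" "j < b" for i j
  proof -
    have "B $$ (i, j) = (\<Sum>l<b. A $$ (i, l) * U $$ (l, j))"
      unfolding B_def using that A U by (auto simp: scalar_prod_def atLeast0LessThan)
    also have "\<dots> = (\<Sum>l<b. \<Sum>k<r. of_real (p k) * x k i * (y k l * U $$ (l, j)))"
      using that by (intro sum.cong refl) (simp add: entries sum_distrib_right mult.assoc)
    also have "\<dots> = (\<Sum>k<r. \<Sum>l<b. of_real (p k) * x k i * (y k l * U $$ (l, j)))" by (rule sum.swap)
    finally show ?thesis by (simp add: sum_distrib_left)
  qed
  \<comment> \<open>Overlaps of the k-th rank-one term with the left and right singular vectors.
    Both are Bessel coefficients, \<open>Y\<close> after complex conjugation.\<close>
  define X where "X k j = (\<Sum>i<a. cnj (W i j) * x k i)" for k j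
  define Y where "Y k j = (\<Sum>l<b. y k l * U $$ (l, j))" for k j
  have "complex_of_real (trace_norm A) = (\<Sum>j<b. of_real (sqrt (s j)))"
    unfolding tn by (simp add: es_s)
  also have "\<dots> = (\<Sum>j<b. \<Sum>k<r. of_real (p k) * (X k j * Y k j))"
  proof (intro sum.cong refl)
    fix j assume "j \<in> {..<b}"
    hence j: "j < b" by simp
    have "of_real (sqrt (s j)) = (\<Sum>i<a. \<Sum>k<r. of_real (p k) * (cnj (W i j) * x k i) * Y k j)"
      unfolding root[OF j] by (intro sum.cong refl) (simp add: Bent j Y_def[symmetric] sum_distrib_left mult_ac)
    also have "\<dots> = (\<Sum>k<r. \<Sum>i<a. of_real (p k) * (cnj (W i j) * x k i) * Y k j)" by (rule sum.swap)
    also have "\<dots> = (\<Sum>k<r. of_real (p k) * (X k j * Y k j))"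
      by (simp add: X_def sum_distrib_left sum_distrib_right mult.assoc)
    finally show "of_real (sqrt (s j)) = (\<Sum>k<r. of_real (p k) * (X k j * Y k j))" .
  qed
  also have "\<dots> = (\<Sum>k<r. of_real (p k) * (\<Sum>j<b. X k j * Y k j))"
    unfolding sum_distrib_left by (rule sum.swap)
  finally have eq: "complex_of_real (trace_norm A) = (\<Sum>k<r. of_real (p k) * (\<Sum>j<b. X k j * Y k j))" .
  have "trace_norm A \<le> cmod (complex_of_real (trace_norm A))" by simp
  also have "\<dots> \<le> (\<Sum>k<r. cmod (of_real (p k) * (\<Sum>j<b. X k j * Y k j)))" unfolding eq by (rule norm_sum)
  also have "\<dots> \<le> (\<Sum>k<r. p k * (sqrt (\<Sum>i<a. (cmod (x k i))\<^sup>2) * sqrt (\<Sum>j<b. (cmod (y k j))\<^sup>2)))"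
  proof (intro sum_mono)
    fix k assume "k \<in> {..<r}"
    hence k: "p k \<ge> 0" using p by simp
    have 1: "(\<Sum>j<b. (cmod (X k j))\<^sup>2) \<le> (\<Sum>i<a. (cmod (x k i))\<^sup>2)"
      unfolding X_def by (rule Bessel_inequality[OF orthW W1])
    have "(\<Sum>j<b. (cmod (Y k j))\<^sup>2) = (\<Sum>j<b. (cmod (\<Sum>i<b. cnj (U $$ (i, j)) * cnj (y k i)))\<^sup>2)"
      unfolding Y_def by (subst complex_mod_cnj[symmetric]) (simp add: mult.commute)
    also have "\<dots> \<le> (\<Sum>i<b. (cmod (cnj (y k i)))\<^sup>2)"
      by (rule Bessel_inequality[where \<nu> = "\<lambda>_. 1"]) (use orthU in auto)
    finally have 2: "(\<Sum>j<b. (cmod (Y k j))\<^sup>2) \<le> (\<Sum>i<b. (cmod (y k i))\<^sup>2)" by simp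
    have "cmod (\<Sum>j<b. X k j * Y k j) \<le> sqrt (\<Sum>j<b. (cmod (X k j))\<^sup>2) * sqrt (\<Sum>j<b. (cmod (Y k j))\<^sup>2)"
      by (rule cmod_sum_mult_le)
    also have "\<dots> \<le> sqrt (\<Sum>i<a. (cmod (x k i))\<^sup>2) * sqrt (\<Sum>j<b. (cmod (y k j))\<^sup>2)"
      by (intro mult_mono) (use 1 2 in \<open>auto simp: sum_nonneg\<close>)
    finally show "cmod (of_real (p k) * (\<Sum>j<b. X k j * Y k j)) \<le>
        p k * (sqrt (\<Sum>i<a. (cmod (x k i))\<^sup>2) * sqrt (\<Sum>j<b. (cmod (y k j))\<^sup>2))"
      using k by (simp add: norm_mult mult_left_mono)
  qed
  finally show ?thesis .
qed

section \<open>Expectation values of product states\<close>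

abbreviation local_indices :: "(nat \<Rightarrow> nat) \<Rightarrow> nat set \<Rightarrow> (nat \<Rightarrow> nat) set" where
  "local_indices d S \<equiv> \<Pi>\<^sub>E l\<in>S. {..<d l}"

lemma encode_cong: "(\<And>l. l \<in> I \<Longrightarrow> f l = g l) \<Longrightarrow> encode d I f = encode d I g"
  by (simp add: encode_def)

text \<open>The largest party is the least significant digit, so adding a new maximum is one Horner
  step. This is the induction step for everything about \<open>encode\<close>.\<close>

lemma encode_insert_greater:
  assumes "finite I" "\<And>l. l \<in> I \<Longrightarrow> l < x"
  shows "encode d (insert x I) f = encode d I f * d x + f x"
proof -
  have x: "x \<notin> I" using assms(2) by auto
  have "{l' \<in> insert x I. x < l'} = {}" using assms(2) by fastforce
  hence 1: "(\<Prod>l'\<in>{l' \<in> insert x I. x < l'}. d l') = 1" by (simp only: prod.empty)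
  have 2: "(\<Prod>l'\<in>{l' \<in> insert x I. l < l'}. d l') = (\<Prod>l'\<in>{l' \<in> I. l < l'}. d l') * d x" if "l \<in> I" for l
  proof -
    have "{l' \<in> insert x I. l < l'} = insert x {l' \<in> I. l < l'}" using assms(2) that by auto
    thus ?thesis using assms(1) x by (simp add: mult.commute)
  qed
  have "(\<Sum>l\<in>I. f l * (\<Prod>l'\<in>{l' \<in> insert x I. l < l'}. d l')) =
      (\<Sum>l\<in>I. f l * (\<Prod>l'\<in>{l' \<in> I. l < l'}. d l') * d x)"
    by (intro sum.cong refl) (simp only: 2 mult.assoc)
  thus ?thesis unfolding encode_def sum.insert[OF assms(1) x] 1 sum_distrib_right by simp
qed

lemma encode_bound_and_digits:
  assumes "finite I" "\<And>l. l \<in> I \<Longrightarrow> f l < d l"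
  shows "encode d I f < totdim d I \<and> (\<forall>l\<in>I. digit d I (encode d I f) l = f l)"
  using assms
proof (induction I rule: finite_linorder_max_induct)
  case empty
  show ?case by (simp add: encode_def totdim_def)
next
  case (insert x I)
  have x: "x \<notin> I" using insert.hyps by auto
  have fx: "f x < d x" using insert.prems by auto
  have IH: "encode d I f < totdim d I" "\<And>l. l \<in> I \<Longrightarrow> digit d I (encode d I f) l = f l"
    using insert by auto
  have e: "encode d (insert x I) f = encode d I f * d x + f x"
    by (rule encode_insert_greater) (use insert in auto)
  have "encode d I f * d x + f x < (encode d I f + 1) * d x" using fx by simp
  also have "\<dots> \<le> totdim d I * d x" by (intro mult_right_mono) (use IH in auto)
  also have "\<dots> = totdim d (insert x I)" using insert.hyps x by (simp add: totdim_def)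
  finally have 1: "encode d (insert x I) f < totdim d (insert x I)" unfolding e .
  have 2: "digit d (insert x I) (encode d (insert x I) f) l = f l" if "l \<in> insert x I" for l
  proof (cases "l = x")
    case True
    have "{l' \<in> insert x I. x < l'} = {}" using insert.hyps by fastforce
    hence "(\<Prod>l'\<in>{l' \<in> insert x I. x < l'}. d l') = 1" by (simp only: prod.empty)
    thus ?thesis unfolding digit_def e True using fx by (simp only:) simp
  next
    case False
    hence l: "l \<in> I" using that by auto
    have "{l' \<in> insert x I. l < l'} = insert x {l' \<in> I. l < l'}" using insert.hyps l by auto
    hence "(\<Prod>l'\<in>{l' \<in> insert x I. l < l'}. d l') = d x * (\<Prod>l'\<in>{l' \<in> I. l < l'}. d l')"
      using insert.hyps x by simp
    moreover have "(encode d I f * d x + f x) div d x = encode d I f" using fx by simp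
    ultimately show ?thesis using IH(2)[OF l] unfolding digit_def e by (simp add: div_mult2_eq)
  qed
  show ?case using 1 2 by blast
qed

lemma encode_lt_totdim: "finite I \<Longrightarrow> f \<in> local_indices d I \<Longrightarrow> encode d I f < totdim d I"
  using encode_bound_and_digits[of I f d] by (auto simp: PiE_def Pi_def)

lemma digit_encode: "finite I \<Longrightarrow> f \<in> local_indices d I \<Longrightarrow> l \<in> I \<Longrightarrow> digit d I (encode d I f) l = f l"
  using encode_bound_and_digits[of I f d] by (auto simp: PiE_def Pi_def)

lemma bij_betw_encode:
  assumes "finite I"
  shows "bij_betw (encode d I) (local_indices d I) {..<totdim d I}"
proof -
  have inj: "inj_on (encode d I) (local_indices d I)"
  proof (rule inj_onI)
    fix f g assume fg: "f \<in> local_indices d I" "g \<in> local_indices d I" "encode d I f = encode d I g"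
    show "f = g"
      by (rule PiE_ext[OF fg(1,2)]) (metis assms digit_encode fg)
  qed
  have "encode d I ` local_indices d I = {..<totdim d I}"
    by (rule card_subset_eq)
      (use inj assms encode_lt_totdim in \<open>auto simp: card_image card_PiE totdim_def\<close>)
  thus ?thesis using inj by (simp add: bij_betw_def)
qed

lemma sum_encode:
  assumes "finite I"
  shows "(\<Sum>a<totdim d I. F a) = (\<Sum>f\<in>local_indices d I. F (encode d I f))"
  using sum.reindex_bij_betw[OF bij_betw_encode[OF assms], of F d] by simp

lemma sum_PiE_Un:
  fixes A B :: "'i set"
  assumes "A \<inter> B = {}"
  shows "(\<Sum>h\<in>PiE (A \<union> B) T. F (restrict h A) (restrict h B)) = (\<Sum>f\<in>PiE A T. \<Sum>g\<in>PiE B T. F f g)"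
proof -
  have "(\<Sum>h\<in>PiE (A \<union> B) T. F (restrict h A) (restrict h B)) = (\<Sum>(f, g)\<in>PiE A T \<times> PiE B T. F f g)"
  proof (rule sum.reindex_bij_witness[where j = "\<lambda>h. (restrict h A, restrict h B)"
        and i = "\<lambda>(f, g) l. if l \<in> A then f l else g l"], goal_cases)
    case (1 h)
    thus ?case by (auto simp: restrict_def PiE_def extensional_def)
  next
    case (3 p)
    obtain f g where p: "p = (f, g)" by (cases p)
    hence "f \<in> extensional A" "g \<in> extensional B" using 3 by (auto simp: PiE_def)
    hence "(\<lambda>l\<in>A. if l \<in> A then f l else g l) = f" "(\<lambda>l\<in>B. if l \<in> A then f l else g l) = g"
      using assms by (auto simp: restrict_def extensional_def fun_eq_iff)
    thus ?case by (simp add: p)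
  next
    case (4 p)
    thus ?case by (auto simp: PiE_def extensional_def Pi_def)
  qed (auto simp: PiE_def)
  thus ?thesis by (simp add: sum.cartesian_product)
qed

text \<open>For a pure state with amplitudes \<open>\<Psi>\<close> of the parties in \<open>S\<close>, this is the expectation value
  \<open>Tr(|\<Psi>\<rangle>\<langle>\<Psi>| \<Otimes>\<^sub>l X l)\<close>.\<close>
definition expect ::
  "(nat \<Rightarrow> nat) \<Rightarrow> nat set \<Rightarrow> ((nat \<Rightarrow> nat) \<Rightarrow> complex) \<Rightarrow> (nat \<Rightarrow> complex mat) \<Rightarrow> complex" where
  "expect d S \<Psi> X = (\<Sum>f\<in>local_indices d S. \<Sum>g\<in>local_indices d S.
     \<Psi> f * cnj (\<Psi> g) * (\<Prod>l\<in>S. X l $$ (g l, f l)))"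

lemma expect_cong: "(\<And>l. l \<in> S \<Longrightarrow> X l = Y l) \<Longrightarrow> expect d S \<Psi> X = expect d S \<Psi> Y"
  by (simp add: expect_def)

lemma prod_delta_funs:
  assumes "finite S" "f \<in> PiE S T" "g \<in> PiE S T"
  shows "(\<Prod>l\<in>S. if g l = f l then 1 else 0) = (if g = f then 1 else (0::complex))"
proof (cases "g = f")
  case False
  then obtain l where "l \<in> S" "g l \<noteq> f l" using PiE_ext[OF assms(3,2)] by blast
  hence "(\<Prod>l\<in>S. if g l = f l then 1 else (0::complex)) = 0"
    by (intro prod_zero) (use assms(1) in auto)
  thus ?thesis using False by simp
qed simp

text \<open>Removes the factor of a group of parties on which only identities act.\<close>

lemma expect_one:
  assumes "finite S" "(\<Sum>f\<in>local_indices d S. (cmod (\<Psi> f))\<^sup>2) = 1" "\<And>l. l \<in> S \<Longrightarrow> X l = 1\<^sub>m (d l)"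
  shows "expect d S \<Psi> X = 1"
proof -
  have fin: "finite (local_indices d S)" using assms(1) by (intro finite_PiE) auto
  have "expect d S \<Psi> X = (\<Sum>f\<in>local_indices d S. \<Sum>g\<in>local_indices d S.
      \<Psi> f * cnj (\<Psi> g) * (if g = f then 1 else 0))"
    unfolding expect_def
  proof (intro sum.cong refl arg_cong2[where f = times])
    fix f g assume fg: "f \<in> local_indices d S" "g \<in> local_indices d S"
    have "(\<Prod>l\<in>S. X l $$ (g l, f l)) = (\<Prod>l\<in>S. if g l = f l then 1 else 0)"
      by (intro prod.cong refl) (use fg assms(3) in \<open>auto simp: PiE_def Pi_def\<close>)
    thus "(\<Prod>l\<in>S. X l $$ (g l, f l)) = (if g = f then 1 else 0)"
      using prod_delta_funs[OF assms(1) fg] by simp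
  qed
  also have "\<dots> = (\<Sum>f\<in>local_indices d S. \<Psi> f * cnj (\<Psi> f))"
    using fin by (intro sum.cong refl) (simp add: if_distrib[of "\<lambda>z. _ * z"] cong: if_cong)
  also have "\<dots> = of_real (\<Sum>f\<in>local_indices d S. (cmod (\<Psi> f))\<^sup>2)"
    by (simp only: of_real_sum complex_norm_square)
  finally show ?thesis using assms(2) by simp
qed

text \<open>The left side has the shape in which \<open>biseparable\<close> presents a product
  state: the parties of both groups interleaved in one global index, each amplitude seeing only a
  restriction of it.\<close>

lemma expect_product_state:
  assumes "finite A" "finite B" "A \<inter> B = {}"
  shows "(\<Sum>f\<in>local_indices d (A \<union> B). \<Sum>g\<in>local_indices d (A \<union> B).
      (\<Psi> (restrict f A) * cnj (\<Psi> (restrict g A))) * (\<Phi> (restrict f B) * cnj (\<Phi> (restrict g B))) *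
      (\<Prod>l\<in>A \<union> B. X l $$ (g l, f l))) = expect d A \<Psi> X * expect d B \<Phi> X"
proof -
  let ?a = "\<lambda>f g. \<Psi> f * cnj (\<Psi> g) * (\<Prod>l\<in>A. X l $$ (g l, f l))"
  let ?b = "\<lambda>f g. \<Phi> f * cnj (\<Phi> g) * (\<Prod>l\<in>B. X l $$ (g l, f l))"
  have "(\<Sum>f\<in>local_indices d (A \<union> B). \<Sum>g\<in>local_indices d (A \<union> B).
      (\<Psi> (restrict f A) * cnj (\<Psi> (restrict g A))) * (\<Phi> (restrict f B) * cnj (\<Phi> (restrict g B))) *
      (\<Prod>l\<in>A \<union> B. X l $$ (g l, f l)))
    = (\<Sum>f\<in>local_indices d (A \<union> B). \<Sum>g\<in>local_indices d (A \<union> B).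
      ?a (restrict f A) (restrict g A) * ?b (restrict f B) (restrict g B))"
    by (intro sum.cong refl) (simp add: prod.union_disjoint assms mult_ac)
  also have "\<dots> = (\<Sum>f\<in>local_indices d (A \<union> B). \<Sum>g\<in>local_indices d A. \<Sum>g'\<in>local_indices d B.
      ?a (restrict f A) g * ?b (restrict f B) g')"
    by (rule sum.cong[OF refl], rule sum_PiE_Un[OF assms(3)])
  also have "\<dots> = (\<Sum>f\<in>local_indices d A. \<Sum>f'\<in>local_indices d B.
      \<Sum>g\<in>local_indices d A. \<Sum>g'\<in>local_indices d B. ?a f g * ?b f' g')"
    by (rule sum_PiE_Un[OF assms(3)])
  also have "\<dots> = expect d A \<Psi> X * expect d B \<Phi> X"
    unfolding expect_def sum_product[symmetric] ..
  finally show ?thesis .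
qed

lemma mtrace_mult_tensor_ops:
  assumes "dim_row \<rho> = totdim d {1..N}" "dim_col \<rho> = totdim d {1..N}"
  shows "mtrace (\<rho> * tensor_ops d N X) =
    (\<Sum>f\<in>local_indices d {1..N}. \<Sum>g\<in>local_indices d {1..N}.
      \<rho> $$ (encode d {1..N} f, encode d {1..N} g) * (\<Prod>l\<in>{1..N}. X l $$ (g l, f l)))"
proof -
  let ?D = "totdim d {1..N}"
  have "mtrace (\<rho> * tensor_ops d N X) = (\<Sum>a<?D. \<Sum>b<?D. \<rho> $$ (a, b) * tensor_ops d N X $$ (b, a))"
    using assms by (simp add: mtrace_def tensor_ops_def scalar_prod_def atLeast0LessThan)
  also have "\<dots> = (\<Sum>f\<in>local_indices d {1..N}. \<Sum>g\<in>local_indices d {1..N}.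
      \<rho> $$ (encode d {1..N} f, encode d {1..N} g) *
      tensor_ops d N X $$ (encode d {1..N} g, encode d {1..N} f))"
    by (simp only: sum_encode[OF finite_atLeastAtMost])
  also have "\<dots> = (\<Sum>f\<in>local_indices d {1..N}. \<Sum>g\<in>local_indices d {1..N}.
      \<rho> $$ (encode d {1..N} f, encode d {1..N} g) * (\<Prod>l\<in>{1..N}. X l $$ (g l, f l)))"
    by (intro sum.cong refl) (simp add: tensor_ops_def encode_lt_totdim digit_encode)
  finally show ?thesis .
qed

lemma pure_state_amplitudes:
  assumes "pure_state (totdim d S) \<sigma>" "finite S"
  shows "\<exists>\<psi>. (\<Sum>f\<in>local_indices d S. (cmod (\<psi> (encode d S f)))\<^sup>2) = 1 \<and>
    (\<forall>f\<in>local_indices d S. \<forall>g\<in>local_indices d S.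
      \<sigma> $$ (encode d S f, encode d S g) = \<psi> (encode d S f) * cnj (\<psi> (encode d S g)))"
proof -
  from assms(1) obtain \<psi> where 1: "(\<Sum>i<totdim d S. (cmod (\<psi> $ i))\<^sup>2) = 1"
    and 2: "\<sigma> = mat (totdim d S) (totdim d S) (\<lambda>(i, j). \<psi> $ i * cnj (\<psi> $ j))"
    unfolding pure_state_def by blast
  have "(\<Sum>f\<in>local_indices d S. (cmod (\<psi> $ encode d S f))\<^sup>2) = 1"
    using 1 unfolding sum_encode[OF assms(2)] .
  thus ?thesis
    by (intro exI[of _ "\<lambda>i. \<psi> $ i"]) (use assms(2) in \<open>auto simp: 2 encode_lt_totdim\<close>)
qed

text \<open>The tensors depend on \<open>\<rho>\<close> only through traces against product
  operators, so the decomposition is recorded at that level and the digit arithmetic of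
  \<open>biseparable\<close> ends here.\<close>

theorem biseparable_expectations:
  assumes "biseparable d N A \<rho>" "A \<subseteq> {1..N}"
  defines "B \<equiv> {1..N} - A"
  obtains r :: nat and p :: "nat \<Rightarrow> real" and \<Psi> \<Phi> where
    "\<And>i. i < r \<Longrightarrow> p i \<ge> 0" "(\<Sum>i<r. p i) = 1"
    "\<And>i. i < r \<Longrightarrow> (\<Sum>f\<in>local_indices d A. (cmod (\<Psi> i f))\<^sup>2) = 1"
    "\<And>i. i < r \<Longrightarrow> (\<Sum>f\<in>local_indices d B. (cmod (\<Phi> i f))\<^sup>2) = 1"
    "\<And>X. mtrace (\<rho> * tensor_ops d N X) =
      (\<Sum>i<r. of_real (p i) * (expect d A (\<Psi> i) X * expect d B (\<Phi> i) X))"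
proof -
  let ?D = "totdim d {1..N}" and ?e = "encode d {1..N}"
  have finA: "finite A" and finB: "finite B" and AB: "A \<union> B = {1..N}" "A \<inter> B = {}"
    using assms(2) by (auto simp: B_def finite_subset)
  from assms(1) obtain r :: nat and p \<sigma> \<tau> where
    p: "\<forall>i<r. p i \<ge> 0 \<and> pure_state (totdim d A) (\<sigma> i) \<and> pure_state (totdim d B) (\<tau> i)"
    and p1: "(\<Sum>i<r. p i) = 1" and dims: "dim_row \<rho> = ?D" "dim_col \<rho> = ?D"
    and \<rho>: "\<forall>a<?D. \<forall>b<?D. \<rho> $$ (a, b) = (\<Sum>i<r. complex_of_real (p i) *
              \<sigma> i $$ (encode d A (digit d {1..N} a), encode d A (digit d {1..N} b)) *
              \<tau> i $$ (encode d B (digit d {1..N} a), encode d B (digit d {1..N} b)))"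
    unfolding biseparable_def Let_def B_def by blast
  \<comment> \<open>The guard \<open>i < r\<close> stands inside the existential so that
    \<open>choice\<close> can be applied to all \<open>i\<close>.\<close>
  have "\<forall>i. \<exists>\<psi>. i < r \<longrightarrow> (\<Sum>f\<in>local_indices d A. (cmod (\<psi> (encode d A f)))\<^sup>2) = 1 \<and>
    (\<forall>f\<in>local_indices d A. \<forall>g\<in>local_indices d A.
      \<sigma> i $$ (encode d A f, encode d A g) = \<psi> (encode d A f) * cnj (\<psi> (encode d A g)))"
    using p pure_state_amplitudes[OF _ finA] by blast
  from choice[OF this] obtain \<psi> where \<psi>: "\<And>i. i < r \<Longrightarrow> (\<Sum>f\<in>local_indices d A. (cmod (\<psi> i (encode d A f)))\<^sup>2) = 1"
    "\<And>i f g. i < r \<Longrightarrow> f \<in> local_indices d A \<Longrightarrow> g \<in> local_indices d A \<Longrightarrow>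
      \<sigma> i $$ (encode d A f, encode d A g) = \<psi> i (encode d A f) * cnj (\<psi> i (encode d A g))"
    by blast
  have "\<forall>i. \<exists>\<phi>. i < r \<longrightarrow> (\<Sum>f\<in>local_indices d B. (cmod (\<phi> (encode d B f)))\<^sup>2) = 1 \<and>
    (\<forall>f\<in>local_indices d B. \<forall>g\<in>local_indices d B.
      \<tau> i $$ (encode d B f, encode d B g) = \<phi> (encode d B f) * cnj (\<phi> (encode d B g)))"
    using p pure_state_amplitudes[OF _ finB] by blast
  from choice[OF this] obtain \<phi> where \<phi>: "\<And>i. i < r \<Longrightarrow> (\<Sum>f\<in>local_indices d B. (cmod (\<phi> i (encode d B f)))\<^sup>2) = 1"
    "\<And>i f g. i < r \<Longrightarrow> f \<in> local_indices d B \<Longrightarrow> g \<in> local_indices d B \<Longrightarrow>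
      \<tau> i $$ (encode d B f, encode d B g) = \<phi> i (encode d B f) * cnj (\<phi> i (encode d B g))"
    by blast
  define \<Psi> where "\<Psi> i f = \<psi> i (encode d A f)" for i f
  define \<Phi> where "\<Phi> i f = \<phi> i (encode d B f)" for i f
  \<comment> \<open>Re-encoding the digits of a global index for a group of parties gives the
    position of the restricted index function; this undoes the interleaving of the two
    groups.\<close>
  have dig: "encode d S (digit d {1..N} (?e f)) = encode d S (restrict f S)"
    if "f \<in> local_indices d {1..N}" "S \<subseteq> {1..N}" for f S
    by (rule encode_cong) (use that digit_encode[OF finite_atLeastAtMost that(1)] in auto)
  have res: "restrict f S \<in> local_indices d S" if "f \<in> local_indices d {1..N}" "S \<subseteq> {1..N}" for f S
    using that by (auto simp: PiE_def Pi_def)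
  have B: "B \<subseteq> {1..N}" by (auto simp: B_def)
  have \<rho>': "\<rho> $$ (?e f, ?e g) = (\<Sum>i<r. of_real (p i) *
      ((\<Psi> i (restrict f A) * cnj (\<Psi> i (restrict g A))) * (\<Phi> i (restrict f B) * cnj (\<Phi> i (restrict g B)))))"
    if "f \<in> local_indices d {1..N}" "g \<in> local_indices d {1..N}" for f g
  proof -
    have "?e f < ?D" "?e g < ?D" using encode_lt_totdim[OF finite_atLeastAtMost] that by blast+
    hence "\<rho> $$ (?e f, ?e g) = (\<Sum>i<r. complex_of_real (p i) *
              \<sigma> i $$ (encode d A (digit d {1..N} (?e f)), encode d A (digit d {1..N} (?e g))) *
              \<tau> i $$ (encode d B (digit d {1..N} (?e f)), encode d B (digit d {1..N} (?e g))))"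
      using \<rho> by blast
    also have "\<dots> = (\<Sum>i<r. complex_of_real (p i) *
        \<sigma> i $$ (encode d A (restrict f A), encode d A (restrict g A)) *
        \<tau> i $$ (encode d B (restrict f B), encode d B (restrict g B)))"
      by (simp only: dig[OF that(1) assms(2)] dig[OF that(2) assms(2)] dig[OF that(1) B] dig[OF that(2) B])
    finally show ?thesis
      by (simp add: \<psi>(2)[OF _ res[OF that(1) assms(2)] res[OF that(2) assms(2)]]
          \<phi>(2)[OF _ res[OF that(1) B] res[OF that(2) B]] \<Psi>_def \<Phi>_def mult.assoc)
  qed
  have "mtrace (\<rho> * tensor_ops d N X) =
      (\<Sum>i<r. of_real (p i) * (expect d A (\<Psi> i) X * expect d B (\<Phi> i) X))" for X
  proof -
    let ?t = "\<lambda>i f g. (\<Psi> i (restrict f A) * cnj (\<Psi> i (restrict g A))) *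
        (\<Phi> i (restrict f B) * cnj (\<Phi> i (restrict g B))) * (\<Prod>l\<in>{1..N}. X l $$ (g l, f l))"
    have "mtrace (\<rho> * tensor_ops d N X) = (\<Sum>f\<in>local_indices d {1..N}. \<Sum>g\<in>local_indices d {1..N}.
        \<Sum>i<r. of_real (p i) * ?t i f g)"
      unfolding mtrace_mult_tensor_ops[OF dims]
      by (intro sum.cong refl) (simp only: \<rho>' sum_distrib_right mult.assoc)
    also have "\<dots> = (\<Sum>f\<in>local_indices d {1..N}. \<Sum>i<r. \<Sum>g\<in>local_indices d {1..N}. of_real (p i) * ?t i f g)"
      by (rule sum.cong[OF refl], rule sum.swap)
    also have "\<dots> = (\<Sum>i<r. \<Sum>f\<in>local_indices d {1..N}. \<Sum>g\<in>local_indices d {1..N}. of_real (p i) * ?t i f g)"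
      by (rule sum.swap)
    also have "\<dots> = (\<Sum>i<r. of_real (p i) * (expect d A (\<Psi> i) X * expect d B (\<Phi> i) X))"
      unfolding sum_distrib_left[symmetric]
      using expect_product_state[OF finA finB AB(2), where d = d and X = X] unfolding AB(1)
      by (intro sum.cong refl arg_cong2[where f = times]) blast
    finally show ?thesis .
  qed
  thus thesis
    using that[of r p \<Psi> \<Phi>] p p1 \<psi>(1) \<phi>(1) by (auto simp: \<Psi>_def \<Phi>_def)
qed

section \<open>Correlations of pure states\<close>

text \<open>Both inequalities double count the pairs \<open>(s, A)\<close> with \<open>s \<in> S - A\<close>, weighted by \<open>c A\<close>, and then discard all
  subsets of intermediate size.\<close>
lemma combinatorial_bound:
  fixes c :: "'a set \<Rightarrow> real" and D :: real and e :: "'a \<Rightarrow> real"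
  assumes fin: "finite S" and nonneg: "\<And>A. A \<subseteq> S \<Longrightarrow> c A \<ge> 0" and c0: "c {} = 1"
    and tot: "(\<Sum>A\<in>Pow S. c A) = D" and D: "D \<ge> 0" and e: "\<And>s. s \<in> S \<Longrightarrow> e s > 0"
    and sub: "\<And>s. s \<in> S \<Longrightarrow> (\<Sum>A\<in>Pow (S - {s}). c A) = D / (e s)\<^sup>2 * (1 + c {s})"
    and t: "card S \<ge> 2"
  shows "(real (card S) - 1) * c S \<le> (real (card S) - 1) * D + 1 - D * (\<Sum>s\<in>S. 1 / (e s)\<^sup>2)"
    and "card S \<ge> 3 \<Longrightarrow> (\<And>s. s \<in> S \<Longrightarrow> D / (e s)\<^sup>2 \<ge> 1) \<Longrightarrow>
      (real (card S) - 2) * c S \<le> (real (card S) - 2) * D + 2 - D * (\<Sum>s\<in>S. 1 / (e s)\<^sup>2)"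
proof -
  let ?t = "real (card S)"
  have "(\<Sum>s\<in>S. \<Sum>A\<in>Pow (S - {s}). c A) = (\<Sum>s\<in>S. \<Sum>A\<in>Pow S. if s \<in> A then 0 else c A)"
  proof (rule sum.cong[OF refl])
    fix s assume "s \<in> S"
    have "Pow (S - {s}) = Pow S - {A. s \<in> A}" by auto
    thus "(\<Sum>A\<in>Pow (S - {s}). c A) = (\<Sum>A\<in>Pow S. if s \<in> A then 0 else c A)"
      using fin by (simp add: sum.If_cases Diff_eq Int_commute)
  qed
  also have "\<dots> = (\<Sum>A\<in>Pow S. \<Sum>s\<in>S. if s \<in> A then 0 else c A)" by (rule sum.swap)
  also have "\<dots> = (\<Sum>A\<in>Pow S. (?t - real (card A)) * c A)"
  proof (rule sum.cong[OF refl])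
    fix A assume "A \<in> Pow S"
    hence A: "A \<subseteq> S" by auto
    have "(\<Sum>s\<in>S. if s \<in> A then 0 else c A) = real (card (S - A)) * c A"
      using fin by (simp add: sum.If_cases Diff_eq Int_commute)
    also have "real (card (S - A)) = ?t - real (card A)"
      using card_Diff_subset[of A S] card_mono[OF fin A] fin A by (simp add: finite_subset of_nat_diff)
    finally show "(\<Sum>s\<in>S. if s \<in> A then 0 else c A) = (?t - real (card A)) * c A" .
  qed
  finally have eq: "(\<Sum>A\<in>Pow S. (?t - real (card A)) * c A) = (\<Sum>s\<in>S. D / (e s)\<^sup>2 * (1 + c {s}))"
    using sub by simp
  \<comment> \<open>The parameter \<open>z\<close> selects which sets get a negative coefficient:
    only the empty one for \<open>z = 1\<close>, also the singletons for
    \<open>z = 2\<close>.\<close>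
  have key: "(\<Sum>A\<in>Pow S. (real (card A) - z) * c A) = (?t - z) * D - (\<Sum>s\<in>S. D / (e s)\<^sup>2 * (1 + c {s}))" for z
  proof -
    have "(\<Sum>A\<in>Pow S. (real (card A) - z) * c A) =
        (\<Sum>A\<in>Pow S. (?t - z) * c A - (?t - real (card A)) * c A)"
      by (intro sum.cong refl) (simp add: algebra_simps)
    also have "\<dots> = (?t - z) * (\<Sum>A\<in>Pow S. c A) - (\<Sum>A\<in>Pow S. (?t - real (card A)) * c A)"
      by (simp add: sum_subtractf sum_distrib_left)
    finally show ?thesis using eq tot by simp
  qed
  have split: "(\<Sum>s\<in>S. D / (e s)\<^sup>2 * (1 + c {s})) = D * (\<Sum>s\<in>S. 1 / (e s)\<^sup>2) + (\<Sum>s\<in>S. D / (e s)\<^sup>2 * c {s})"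
    by (simp add: sum_distrib_left distrib_left sum.distrib)
  have cs: "c {s} \<ge> 0" if "s \<in> S" for s using nonneg[of "{s}"] that by auto
  have S0: "S \<noteq> {}" using t by auto
  have finA: "finite A" "card A = 0 \<longleftrightarrow> A = {}" if "A \<subseteq> S" for A
    using that fin by (auto simp: finite_subset)
  have "- 1 + (?t - 1) * c S = (\<Sum>A\<in>{{}, S}. (real (card A) - 1) * c A)" using S0 by (simp add: c0)
  also have "\<dots> \<le> (\<Sum>A\<in>Pow S. (real (card A) - 1) * c A)"
  proof (rule sum_mono2)
    fix A assume A: "A \<in> Pow S - {{}, S}"
    hence "card A \<ge> 1" using finA[of A] by (cases "card A") auto
    thus "0 \<le> (real (card A) - 1) * c A" using nonneg[of A] A by auto
  qed (use fin in auto)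
  finally have "- 1 + (?t - 1) * c S \<le> (?t - 1) * D - D * (\<Sum>s\<in>S. 1 / (e s)\<^sup>2) - (\<Sum>s\<in>S. D / (e s)\<^sup>2 * c {s})"
    unfolding key split by simp
  \<comment> \<open>For \<open>z = 1\<close> singletons have coefficient 0 on the left, so their
    contribution on the right is simply dropped.\<close>
  moreover have "(\<Sum>s\<in>S. D / (e s)\<^sup>2 * c {s}) \<ge> 0" using cs D by (intro sum_nonneg) auto
  ultimately show "(?t - 1) * c S \<le> (?t - 1) * D + 1 - D * (\<Sum>s\<in>S. 1 / (e s)\<^sup>2)" by linarith
  assume t3: "card S \<ge> 3" and big: "\<And>s. s \<in> S \<Longrightarrow> D / (e s)\<^sup>2 \<ge> 1"
  let ?X = "insert {} (insert S ((\<lambda>s. {s}) ` S))"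
  have nin: "{} \<notin> insert S ((\<lambda>s. {s}) ` S)" using S0 by auto
  have "S \<notin> (\<lambda>s. {s}) ` S"
  proof
    assume "S \<in> (\<lambda>s. {s}) ` S"
    then obtain s where "S = {s}" by blast
    hence "card S = 1" by (metis card_1_singleton_iff One_nat_def)
    thus False using t3 by simp
  qed
  hence "(\<Sum>A\<in>?X. (real (card A) - 2) * c A) = - 2 + (?t - 2) * c S + (\<Sum>A\<in>(\<lambda>s. {s}) ` S. (real (card A) - 2) * c A)"
    using fin nin by (subst sum.insert; (subst sum.insert)?) (auto simp: c0)
  also have "(\<Sum>A\<in>(\<lambda>s. {s}) ` S. (real (card A) - 2) * c A) = - (\<Sum>s\<in>S. c {s})"
    by (subst sum.reindex) (auto simp: sum_negf)
  finally have "- 2 + (?t - 2) * c S - (\<Sum>s\<in>S. c {s}) = (\<Sum>A\<in>?X. (real (card A) - 2) * c A)" by simp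
  also have "\<dots> \<le> (\<Sum>A\<in>Pow S. (real (card A) - 2) * c A)"
  proof (rule sum_mono2)
    fix A assume A: "A \<in> Pow S - ?X"
    have "card A \<noteq> 0" using A finA[of A] by auto
    moreover have "card A \<noteq> 1" using A by (auto simp: card_1_singleton_iff)
    ultimately have "card A \<ge> 2" by linarith
    thus "0 \<le> (real (card A) - 2) * c A" using nonneg[of A] A by auto
  qed (use fin in auto)
  finally have "- 2 + (?t - 2) * c S - (\<Sum>s\<in>S. c {s}) \<le>
      (?t - 2) * D - D * (\<Sum>s\<in>S. 1 / (e s)\<^sup>2) - (\<Sum>s\<in>S. D / (e s)\<^sup>2 * c {s})"
    unfolding key split by simp
  \<comment> \<open>The singletons enter with coefficient -1 when \<open>z = 2\<close>; the
    assumption that \<open>D / (e s)\<^sup>2\<close> is at least 1 is what lets the right side pay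
    for them.\<close>
  moreover have "(\<Sum>s\<in>S. c {s}) \<le> (\<Sum>s\<in>S. D / (e s)\<^sup>2 * c {s})"
  proof (rule sum_mono)
    fix s assume "s \<in> S"
    thus "c {s} \<le> D / (e s)\<^sup>2 * c {s}" using mult_right_mono[OF big cs, of s s] by simp
  qed
  ultimately show "(?t - 2) * c S \<le> (?t - 2) * D + 2 - D * (\<Sum>s\<in>S. 1 / (e s)\<^sup>2)" by linarith
qed

section \<open>Weighted orthogonality and completeness of the local operator bases\<close>

lemma sum_div_mod:
  fixes F :: "nat \<Rightarrow> nat \<Rightarrow> 'a :: comm_monoid_add"
  shows "(\<Sum>q<a * b. F (q div b) (q mod b)) = (\<Sum>i<a. \<Sum>j<b. F i j)"
proof -
  have "(\<Sum>q<a * b. F (q div b) (q mod b)) = (\<Sum>i<a. \<Sum>q\<in>{i * b..<i * b + b}. F (q div b) (q mod b))"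
    by (rule sum.nat_group[symmetric])
  also have "\<dots> = (\<Sum>i<a. \<Sum>j<b. F i j)"
  proof (rule sum.cong[OF refl])
    fix i
    have "(\<Sum>q\<in>{i * b..<i * b + b}. F (q div b) (q mod b)) = (\<Sum>q\<in>{0 + i * b..<b + i * b}. F (q div b) (q mod b))"
      by (simp add: add.commute)
    also have "\<dots> = (\<Sum>j\<in>{0..<b}. F ((j + i * b) div b) ((j + i * b) mod b))"
      by (rule sum.shift_bounds_nat_ivl)
    also have "\<dots> = (\<Sum>j<b. F i j)" by (simp add: atLeast0LessThan)
    finally show "(\<Sum>q\<in>{i * b..<i * b + b}. F (q div b) (q mod b)) = (\<Sum>j<b. F i j)" .
  qed
  finally show ?thesis .
qed

lemma mtrace_adjoint_mult:
  assumes "A \<in> carrier_mat n n" "B \<in> carrier_mat n n"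
  shows "mtrace (mat_adjoint A * B) = (\<Sum>j<n. \<Sum>i<n. cnj (A $$ (i, j)) * B $$ (i, j))"
  unfolding mtrace_def using assms by (simp add: index_adjoint_mult[OF assms] del: index_mult_mat(1))

text \<open>Relative to a set \<open>S\<close> of parties, so that it serves both sides of the
  bipartition.\<close>

locale operator_bases =
  fixes d :: "nat \<Rightarrow> nat" and \<kappa> :: "nat \<Rightarrow> real" and G :: "nat \<Rightarrow> nat \<Rightarrow> complex mat" and S :: "nat set"
  assumes fin: "finite S"
    and G_dim: "\<And>s i. s \<in> S \<Longrightarrow> i < (d s)\<^sup>2 \<Longrightarrow> G s i \<in> carrier_mat (d s) (d s)"
    and G_0: "\<And>s. s \<in> S \<Longrightarrow> G s 0 = 1\<^sub>m (d s)"
    and G_tr: "\<And>s i. s \<in> S \<Longrightarrow> 1 \<le> i \<Longrightarrow> i < (d s)\<^sup>2 \<Longrightarrow> mtrace (G s i) = 0"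
    and G_orth: "\<And>s i i'. s \<in> S \<Longrightarrow> 1 \<le> i \<Longrightarrow> i < (d s)\<^sup>2 \<Longrightarrow> 1 \<le> i' \<Longrightarrow> i' < (d s)\<^sup>2 \<Longrightarrow>
                  mtrace (mat_adjoint (G s i) * G s i') = (if i = i' then complex_of_real (\<kappa> s) else 0)"
    and \<kappa>: "\<And>s. s \<in> S \<Longrightarrow> \<kappa> s \<ge> 1"
begin

text \<open>The identity has squared Hilbert-Schmidt norm \<open>d s\<close>, the other basis
  elements have \<open>\<kappa> s\<close>. Scaling by the square root of the weight gives all of
  them the squared norm \<open>d s\<close>.\<close>

definition weight :: "nat \<Rightarrow> nat \<Rightarrow> real" where
  "weight s i = (if i = 0 then 1 else real (d s) / \<kappa> s)"

lemma weight_nonneg: "s \<in> S \<Longrightarrow> weight s i \<ge> 0"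
  using \<kappa>[of s] by (simp add: weight_def)

lemma weighted_orthogonality:
  assumes s: "s \<in> S" and i: "i < (d s)\<^sup>2" and j: "j < (d s)\<^sup>2"
  shows "complex_of_real (sqrt (weight s i) * sqrt (weight s j)) * mtrace (mat_adjoint (G s i) * G s j) =
    (if i = j then of_nat (d s) else 0)"
proof -
  have one: "mat_adjoint (1\<^sub>m (d s) :: complex mat) = 1\<^sub>m (d s)" by (rule eq_matI) auto
  have tr1: "mtrace (1\<^sub>m (d s)) = of_nat (d s)" by (simp add: mtrace_def)
  have tradj: "mtrace (mat_adjoint A) = cnj (mtrace A)" if "A \<in> carrier_mat n n" for A n
    using that by (simp add: mtrace_def)
  consider "i = 0" "j = 0" | "i = 0" "j \<ge> 1" | "i \<ge> 1" "j = 0" | "i \<ge> 1" "j \<ge> 1" by linarith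
  thus ?thesis
  proof cases
    case 1
    thus ?thesis using s by (simp add: G_0 one tr1 weight_def)
  next
    case 2
    have "mat_adjoint (G s i) * G s j = G s j" using 2 s G_dim[OF s j] by (simp add: G_0 one)
    thus ?thesis using 2 G_tr[OF s _ j] by simp
  next
    case 3
    have "mat_adjoint (G s i) * G s j = mat_adjoint (G s i)"
      using 3 s G_dim[OF s i] by (simp add: G_0 right_mult_one_mat[of _ "d s" "d s"])
    thus ?thesis using 3 G_tr[OF s _ i] tradj[OF G_dim[OF s i]] by simp
  next
    case 4
    show ?thesis
    proof (cases "i = j")
      case True
      have "sqrt (weight s i) * sqrt (weight s j) = real (d s) / \<kappa> s"
        using True 4 \<kappa>[OF s] by (simp add: weight_def)
      moreover have "complex_of_real (real (d s) / \<kappa> s) * complex_of_real (\<kappa> s) = of_nat (d s)"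
        using \<kappa>[OF s] by simp
      ultimately show ?thesis using True 4 G_orth[OF s _ i _ j] by simp
    next
      case False
      thus ?thesis using 4 G_orth[OF s _ i _ j] by simp
    qed
  qed
qed

text \<open>A square matrix with orthonormal rows has orthonormal columns. The rows are the rescaled
  flattened basis elements, and there are as many of them as matrix entries; the columns give the
  claim.\<close>

lemma completeness:
  assumes s: "s \<in> S" and a: "a < d s" "b < d s" "a' < d s" "b' < d s"
  shows "(\<Sum>i<(d s)\<^sup>2. of_real (weight s i) * (G s i $$ (a, b) * cnj (G s i $$ (a', b')))) =
    (if a = a' \<and> b = b' then of_nat (d s) else 0)"
proof -
  let ?d = "d s" let ?n = "(d s)\<^sup>2"
  have d0: "?d > 0" using a by simp
  have n: "?n = ?d * ?d" by (simp add: power2_eq_square)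
  \<comment> \<open>Flattening is column by column (\<open>q mod ?d\<close> is the row), matching
    the order of summation in \<open>mtrace_adjoint_mult\<close>.\<close>
  define M where "M = mat ?n ?n (\<lambda>(i, q). complex_of_real (sqrt (weight s i)) * cnj (G s i $$ (q mod ?d, q div ?d)))"
  have M: "M \<in> carrier_mat ?n ?n" by (simp add: M_def)
  have M': "mat_adjoint M \<in> carrier_mat ?n ?n" using M by simp
  define M2 where "M2 = (1 / of_nat ?d) \<cdot>\<^sub>m mat_adjoint M"
  have M2: "M2 \<in> carrier_mat ?n ?n" using M' by (simp add: M2_def)
  have "M * mat_adjoint M = of_nat ?d \<cdot>\<^sub>m 1\<^sub>m ?n"
  proof (rule eq_matI)
    fix i j assume "i < dim_row (of_nat ?d \<cdot>\<^sub>m (1\<^sub>m ?n :: complex mat))" "j < dim_col (of_nat ?d \<cdot>\<^sub>m (1\<^sub>m ?n :: complex mat))"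
    hence i: "i < ?n" and j: "j < ?n" by auto
    have "(M * mat_adjoint M) $$ (i, j) = (\<Sum>q<?n. M $$ (i, q) * cnj (M $$ (j, q)))"
      using i j M by (simp add: scalar_prod_def atLeast0LessThan)
    also have "\<dots> = (\<Sum>q<?d * ?d. complex_of_real (sqrt (weight s i) * sqrt (weight s j)) *
        (cnj (G s i $$ (q mod ?d, q div ?d)) * G s j $$ (q mod ?d, q div ?d)))"
      unfolding n[symmetric] by (intro sum.cong refl) (use i j in \<open>simp add: M_def mult_ac\<close>)
    also have "\<dots> = complex_of_real (sqrt (weight s i) * sqrt (weight s j)) *
        mtrace (mat_adjoint (G s i) * G s j)"
      unfolding mtrace_adjoint_mult[OF G_dim[OF s i] G_dim[OF s j]] sum_distrib_left[symmetric]
      by (subst sum_div_mod[where F = "\<lambda>x y. cnj (G s i $$ (y, x)) * G s j $$ (y, x)"]) simp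
    finally show "(M * mat_adjoint M) $$ (i, j) = (of_nat ?d \<cdot>\<^sub>m 1\<^sub>m ?n) $$ (i, j)"
      using weighted_orthogonality[OF s i j] i j by simp
  qed (use M in auto)
  hence "M * M2 = (1 / of_nat ?d) \<cdot>\<^sub>m (of_nat ?d \<cdot>\<^sub>m 1\<^sub>m ?n)"
    unfolding M2_def using mult_smult_distrib[OF M M', of "1 / of_nat ?d"] by simp
  also have "\<dots> = 1\<^sub>m ?n" by (rule eq_matI) (use d0 in auto)
  finally have "M * M2 = 1\<^sub>m ?n" .
  hence "M2 * M = 1\<^sub>m ?n" using mat_mult_left_right_inverse[OF M M2] by blast
  hence eq: "(1 / of_nat ?d) \<cdot>\<^sub>m (mat_adjoint M * M) = 1\<^sub>m ?n"
    unfolding M2_def using mult_smult_assoc_mat[OF M' M] by metis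
  let ?q = "b * ?d + a" and ?q' = "b' * ?d + a'"
  have bound: "y * ?d + x < ?n" if "x < ?d" "y < ?d" for x y
  proof -
    have "y * ?d + x < (y + 1) * ?d" using that by simp
    also have "\<dots> \<le> ?d * ?d" using that by (intro mult_right_mono) auto
    finally show ?thesis by (simp add: n)
  qed
  have q: "?q < ?n" "?q' < ?n" using bound a by auto
  have qq: "?q = ?q' \<longleftrightarrow> a = a' \<and> b = b'"
  proof -
    have "?q mod ?d = a" "?q div ?d = b" "?q' mod ?d = a'" "?q' div ?d = b'" using a by auto
    thus ?thesis by metis
  qed
  have "(1 / of_nat ?d) * (\<Sum>i<?n. cnj (M $$ (i, ?q)) * M $$ (i, ?q')) = (if ?q = ?q' then 1 else 0)"
    using arg_cong[OF eq, of "\<lambda>X. X $$ (?q, ?q')"] q M index_adjoint_mult[OF M M q] by simp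
  hence "(\<Sum>i<?n. cnj (M $$ (i, ?q)) * M $$ (i, ?q')) = (if ?q = ?q' then of_nat ?d else 0)"
    using d0 by (cases "?q = ?q'") (simp_all add: divide_eq_eq)
  moreover have "(\<Sum>i<?n. cnj (M $$ (i, ?q)) * M $$ (i, ?q')) =
      (\<Sum>i<?n. of_real (weight s i) * (G s i $$ (a, b) * cnj (G s i $$ (a', b'))))"
  proof (intro sum.cong refl)
    fix i assume i: "i \<in> {..<?n}"
    have w: "complex_of_real (sqrt (weight s i)) * complex_of_real (sqrt (weight s i)) = of_real (weight s i)"
    proof -
      have "sqrt (weight s i) * sqrt (weight s i) = weight s i" using weight_nonneg[OF s, of i] by simp
      thus ?thesis by (metis of_real_mult)
    qed
    have "cnj (M $$ (i, ?q)) * M $$ (i, ?q') = complex_of_real (sqrt (weight s i)) * complex_of_real (sqrt (weight s i)) *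
        (G s i $$ (a, b) * cnj (G s i $$ (a', b')))"
      using i q a by (simp add: M_def mult_ac)
    thus "cnj (M $$ (i, ?q)) * M $$ (i, ?q') = of_real (weight s i) * (G s i $$ (a, b) * cnj (G s i $$ (a', b')))"
      unfolding w .
  qed
  ultimately show ?thesis unfolding qq by simp
qed

section \<open>Correlation sectors and purities of reduced states\<close>

abbreviation indices where "indices \<equiv> local_indices d S"

abbreviation pairs where "pairs \<equiv> indices \<times> indices"

text \<open>Index 0 is the identity, so these are the multi-indices whose operator acts nontrivially
  exactly on the parties in \<open>A\<close>; \<open>closed_sector\<close> allows fewer
  parties.\<close>

definition sector :: "nat set \<Rightarrow> (nat \<Rightarrow> nat) set" where
  "sector A = (\<Pi>\<^sub>E l\<in>S. if l \<in> A then {1..<(d l)\<^sup>2} else {0})"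

definition closed_sector :: "nat set \<Rightarrow> (nat \<Rightarrow> nat) set" where
  "closed_sector B = (\<Pi>\<^sub>E l\<in>S. if l \<in> B then {..<(d l)\<^sup>2} else {0})"

definition corr_weight :: "((nat \<Rightarrow> nat) \<Rightarrow> complex) \<Rightarrow> (nat \<Rightarrow> nat) \<Rightarrow> real" where
  "corr_weight \<Psi> i = (\<Prod>l\<in>S. weight l (i l)) * (cmod (expect d S \<Psi> (\<lambda>l. G l (i l))))\<^sup>2"

text \<open>This is the quantity c A of the overview.\<close>

definition sector_weight :: "((nat \<Rightarrow> nat) \<Rightarrow> complex) \<Rightarrow> nat set \<Rightarrow> real" where
  "sector_weight \<Psi> A = (\<Sum>i\<in>sector A. corr_weight \<Psi> i)"

text \<open>\<open>purity \<Psi> B\<close> is \<open>Tr \<rho>\<^sub>B\<^sup>2\<close> for the reduced state of \<open>\<Psi>\<close>; the two index pairs \<open>(f, g)\<close>, \<open>(f', g')\<close>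
  belong to the two copies of \<open>|\<Psi>\<rangle>\<langle>\<Psi>|\<close>.\<close>
definition purity :: "((nat \<Rightarrow> nat) \<Rightarrow> complex) \<Rightarrow> nat set \<Rightarrow> complex" where
  "purity \<Psi> B = (\<Sum>(f, g)\<in>pairs. \<Sum>(f', g')\<in>pairs. \<Psi> f * cnj (\<Psi> g) * cnj (\<Psi> f') * \<Psi> g' *
     (\<Prod>l\<in>S. if l \<in> B then (if g l = g' l \<and> f l = f' l then 1 else 0)
             else (if g l = f l \<and> g' l = f' l then 1 else 0)))"

lemma finite_pairs: "finite pairs" and finite_sector: "finite (sector A)"
  using fin by (auto simp: sector_def intro!: finite_PiE)

lemma corr_weight_nonneg: "corr_weight \<Psi> i \<ge> 0"
  unfolding corr_weight_def by (intro mult_nonneg_nonneg prod_nonneg) (auto simp: weight_nonneg)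

lemma sector_weight_nonneg: "sector_weight \<Psi> A \<ge> 0"
  unfolding sector_weight_def by (intro sum_nonneg corr_weight_nonneg)

text \<open>Every multi-index lies in the sector of its own support and in no other. Positivity of
  the dimensions keeps the index 0 in the range below \<open>(d l)\<^sup>2\<close>.\<close>

lemma sum_sectors:
  assumes "B \<subseteq> S" and d: "\<And>l. l \<in> S \<Longrightarrow> d l > 0"
  shows "(\<Sum>A\<in>Pow B. sector_weight \<Psi> A) = (\<Sum>i\<in>closed_sector B. corr_weight \<Psi> i)"
proof -
  have sec: "i \<in> sector A \<longleftrightarrow> i \<in> extensional S \<and> (\<forall>l\<in>S. i l < (d l)\<^sup>2 \<and> (i l \<noteq> 0 \<longleftrightarrow> l \<in> A))" for i A
  proof -
    have "i l \<in> (if l \<in> A then {1..<(d l)\<^sup>2} else {0}) \<longleftrightarrow> i l < (d l)\<^sup>2 \<and> (i l \<noteq> 0 \<longleftrightarrow> l \<in> A)"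
      if "l \<in> S" for l using d[OF that] by auto
    thus ?thesis by (auto simp: sector_def PiE_iff)
  qed
  have clo: "i \<in> closed_sector B \<longleftrightarrow> i \<in> extensional S \<and> (\<forall>l\<in>S. i l < (d l)\<^sup>2 \<and> (i l \<noteq> 0 \<longrightarrow> l \<in> B))" for i
  proof -
    have "i l \<in> (if l \<in> B then {..<(d l)\<^sup>2} else {0}) \<longleftrightarrow> i l < (d l)\<^sup>2 \<and> (i l \<noteq> 0 \<longrightarrow> l \<in> B)"
      if "l \<in> S" for l using d[OF that] by auto
    thus ?thesis by (auto simp: closed_sector_def PiE_iff)
  qed
  have union: "closed_sector B = (\<Union>A\<in>Pow B. sector A)"
  proof (intro equalityI subsetI)
    fix i assume "i \<in> closed_sector B"
    hence "i \<in> sector {l\<in>S. i l \<noteq> 0}" "{l\<in>S. i l \<noteq> 0} \<subseteq> B" unfolding clo sec by auto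
    thus "i \<in> (\<Union>A\<in>Pow B. sector A)" by blast
  next
    fix i assume "i \<in> (\<Union>A\<in>Pow B. sector A)"
    thus "i \<in> closed_sector B" unfolding clo by (auto simp: sec)
  qed
  have "sector A \<inter> sector A' = {}" if "A \<in> Pow B" "A' \<in> Pow B" "A \<noteq> A'" for A A'
    using that assms(1) by (auto simp: sec)
  moreover have "finite B" using fin assms(1) by (rule finite_subset[rotated])
  ultimately show ?thesis unfolding sector_weight_def union
    by (intro sum.UNION_disjoint[symmetric]) (auto simp: finite_sector)
qed

text \<open>The squared modulus is a sum over two copies \<open>p\<close>, \<open>q\<close> of the
  index pairs, in which the sum over multi-indices factors over the parties. Completeness then
  contracts the copies with each other at the parties in \<open>B\<close>, while the identity traces
  out each copy separately elsewhere.\<close>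

lemma sum_closed_sector:
  assumes B: "B \<subseteq> S"
  shows "of_real (\<Sum>i\<in>closed_sector B. corr_weight \<Psi> i) = of_nat (\<Prod>l\<in>B. d l) * purity \<Psi> B"
proof -
  define a where "a = (\<lambda>(f, g). \<Psi> f * cnj (\<Psi> g))"
  define T where "T l = (if l \<in> B then {..<(d l)\<^sup>2} else {0})" for l
  define \<delta> where "\<delta> l p q = (if l \<in> B then (if snd p l = snd q l \<and> fst p l = fst q l then 1 else 0)
             else (if snd p l = fst p l \<and> snd q l = fst q l then 1 else (0::complex)))"
    for l :: nat and p q :: "(nat \<Rightarrow> nat) \<times> (nat \<Rightarrow> nat)"
  let ?x = "\<lambda>l i p. G l i $$ (snd p l, fst p l)"
  have E: "expect d S \<Psi> (\<lambda>l. G l (i l)) = (\<Sum>p\<in>pairs. a p * (\<Prod>l\<in>S. ?x l (i l) p))" for i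
    unfolding expect_def a_def by (simp add: sum.cartesian_product case_prod_beta)
  have cw: "of_real (corr_weight \<Psi> i) = (\<Sum>p\<in>pairs. \<Sum>q\<in>pairs. a p * cnj (a q) *
      (\<Prod>l\<in>S. of_real (weight l (i l)) * (?x l (i l) p * cnj (?x l (i l) q))))" for i
  proof -
    have "of_real (corr_weight \<Psi> i) = (\<Prod>l\<in>S. of_real (weight l (i l))) *
        ((\<Sum>p\<in>pairs. a p * (\<Prod>l\<in>S. ?x l (i l) p)) * cnj (\<Sum>q\<in>pairs. a q * (\<Prod>l\<in>S. ?x l (i l) q)))"
      unfolding corr_weight_def E[symmetric] of_real_mult of_real_prod complex_norm_square ..
    also have "\<dots> = (\<Sum>p\<in>pairs. \<Sum>q\<in>pairs. (\<Prod>l\<in>S. of_real (weight l (i l))) *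
        (a p * (\<Prod>l\<in>S. ?x l (i l) p) * (cnj (a q) * (\<Prod>l\<in>S. cnj (?x l (i l) q)))))"
      unfolding cnj_sum complex_cnj_mult cnj_prod sum_product unfolding sum_distrib_left ..
    also have "\<dots> = (\<Sum>p\<in>pairs. \<Sum>q\<in>pairs. a p * cnj (a q) *
      (\<Prod>l\<in>S. of_real (weight l (i l)) * (?x l (i l) p * cnj (?x l (i l) q))))"
      unfolding prod.distrib by (intro sum.cong refl) (simp only: mult_ac)
    finally show ?thesis .
  qed
  \<comment> \<open>Inside \<open>B\<close> this is \<open>completeness\<close>, which supplies a
    factor \<open>d l\<close>; outside \<open>B\<close> only the identity with weight 1
    remains.\<close>
  have local: "(\<Sum>i\<in>T l. of_real (weight l i) * (?x l i p * cnj (?x l i q))) =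
      (if l \<in> B then of_nat (d l) else 1) * \<delta> l p q" if l: "l \<in> S" and pq: "p \<in> pairs" "q \<in> pairs" for l p q
  proof -
    have lt: "fst p l < d l" "snd p l < d l" "fst q l < d l" "snd q l < d l"
      using l pq by (auto simp: PiE_def Pi_def)
    show ?thesis
    proof (cases "l \<in> B")
      case True
      thus ?thesis using completeness[OF l lt(2,1,4,3)] by (simp add: T_def \<delta>_def)
    next
      case False
      thus ?thesis using lt l by (simp add: T_def \<delta>_def weight_def G_0)
    qed
  qed
  have finT: "finite (T l)" for l by (simp add: T_def)
  have "of_real (\<Sum>i\<in>closed_sector B. corr_weight \<Psi> i) = (\<Sum>i\<in>PiE S T. \<Sum>p\<in>pairs. \<Sum>q\<in>pairs. a p * cnj (a q) *
      (\<Prod>l\<in>S. of_real (weight l (i l)) * (?x l (i l) p * cnj (?x l (i l) q))))"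
    unfolding of_real_sum cw closed_sector_def T_def ..
  also have "\<dots> = (\<Sum>p\<in>pairs. \<Sum>i\<in>PiE S T. \<Sum>q\<in>pairs. a p * cnj (a q) *
      (\<Prod>l\<in>S. of_real (weight l (i l)) * (?x l (i l) p * cnj (?x l (i l) q))))" by (rule sum.swap)
  also have "\<dots> = (\<Sum>p\<in>pairs. \<Sum>q\<in>pairs. \<Sum>i\<in>PiE S T. a p * cnj (a q) *
      (\<Prod>l\<in>S. of_real (weight l (i l)) * (?x l (i l) p * cnj (?x l (i l) q))))"
    by (rule sum.cong[OF refl], rule sum.swap)
  also have "\<dots> = (\<Sum>p\<in>pairs. \<Sum>q\<in>pairs. a p * cnj (a q) *
      (\<Prod>l\<in>S. \<Sum>i\<in>T l. of_real (weight l i) * (?x l i p * cnj (?x l i q))))"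
    unfolding sum_distrib_left[symmetric] prod_sum_PiE[OF fin finT] ..
  also have "\<dots> = (\<Sum>p\<in>pairs. \<Sum>q\<in>pairs. a p * cnj (a q) *
      (\<Prod>l\<in>S. (if l \<in> B then of_nat (d l) else 1) * \<delta> l p q))"
    by (intro sum.cong refl arg_cong2[where f = times] prod.cong) (rule local)
  also have "\<dots> = (\<Sum>p\<in>pairs. \<Sum>q\<in>pairs. of_nat (\<Prod>l\<in>B. d l) * (a p * cnj (a q) * (\<Prod>l\<in>S. \<delta> l p q)))"
  proof -
    have "(\<Prod>l\<in>S. if l \<in> B then of_nat (d l) else (1::complex)) = of_nat (\<Prod>l\<in>B. d l)"
      using fin B by (simp add: prod.If_cases Int_absorb1)
    thus ?thesis unfolding prod.distrib by (intro sum.cong refl) (simp only: mult_ac)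
  qed
  also have "\<dots> = of_nat (\<Prod>l\<in>B. d l) * purity \<Psi> B"
    unfolding purity_def sum_distrib_left[symmetric] a_def \<delta>_def
    by (simp add: case_prod_beta mult_ac)
  finally show ?thesis .
qed

text \<open>Exchanging \<open>f\<close> with \<open>g'\<close>, the indices of the two unconjugated amplitudes, turns the contraction
  pattern of \<open>B\<close> into that of its complement.\<close>
lemma purity_complement: "purity \<Psi> (S - B) = purity \<Psi> B"
proof -
  define F where "F B f g f' g' = \<Psi> f * cnj (\<Psi> g) * cnj (\<Psi> f') * \<Psi> g' *
     (\<Prod>l\<in>S. if l \<in> B then (if g l = g' l \<and> f l = f' l then 1 else 0)
             else (if g l = f l \<and> g' l = f' l then 1 else 0))" for B f g f' g'
  have pur: "purity \<Psi> B = (\<Sum>f\<in>indices. \<Sum>g\<in>indices. \<Sum>f'\<in>indices. \<Sum>g'\<in>indices. F B f g f' g')" for B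
    unfolding purity_def F_def sum.cartesian_product[symmetric] ..
  have F: "F (S - B) f g f' g' = F B g' g f' f" for f g f' g'
  proof -
    have "(\<Prod>l\<in>S. if l \<in> S - B then (if g l = g' l \<and> f l = f' l then 1 else 0)
             else (if g l = f l \<and> g' l = f' l then 1 else 0)) =
       (\<Prod>l\<in>S. if l \<in> B then (if g l = f l \<and> g' l = f' l then 1 else 0)
             else (if g l = g' l \<and> f l = f' l then 1 else (0::complex)))"
      by (rule prod.cong) auto
    thus ?thesis unfolding F_def by (simp only: mult_ac)
  qed
  let ?I = indices
  have "purity \<Psi> (S - B) = (\<Sum>f\<in>?I. \<Sum>g\<in>?I. \<Sum>f'\<in>?I. \<Sum>g'\<in>?I. F B g' g f' f)"
    unfolding pur F ..
  also have "\<dots> = (\<Sum>f\<in>?I. \<Sum>g\<in>?I. \<Sum>g'\<in>?I. \<Sum>f'\<in>?I. F B g' g f' f)"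
    by (rule sum.cong[OF refl], rule sum.cong[OF refl], rule sum.swap)
  also have "\<dots> = (\<Sum>f\<in>?I. \<Sum>g'\<in>?I. \<Sum>g\<in>?I. \<Sum>f'\<in>?I. F B g' g f' f)"
    by (rule sum.cong[OF refl], rule sum.swap)
  also have "\<dots> = (\<Sum>g'\<in>?I. \<Sum>f\<in>?I. \<Sum>g\<in>?I. \<Sum>f'\<in>?I. F B g' g f' f)" by (rule sum.swap)
  also have "\<dots> = (\<Sum>g'\<in>?I. \<Sum>g\<in>?I. \<Sum>f\<in>?I. \<Sum>f'\<in>?I. F B g' g f' f)"
    by (rule sum.cong[OF refl], rule sum.swap)
  also have "\<dots> = (\<Sum>g'\<in>?I. \<Sum>g\<in>?I. \<Sum>f'\<in>?I. \<Sum>f\<in>?I. F B g' g f' f)"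
    by (rule sum.cong[OF refl], rule sum.cong[OF refl], rule sum.swap)
  finally show ?thesis unfolding pur .
qed

text \<open>For \<open>B = S\<close> the contraction identifies the two copies, which leaves the
  square of the squared norm of \<open>\<Psi>\<close>.\<close>

lemma purity_full:
  assumes "(\<Sum>f\<in>indices. (cmod (\<Psi> f))\<^sup>2) = 1"
  shows "purity \<Psi> S = 1"
proof -
  have delta: "(\<Prod>l\<in>S. if l \<in> S then (if g l = g' l \<and> f l = f' l then 1 else 0)
             else (if g l = f l \<and> g' l = f' l then 1 else 0)) = (if (f', g') = (f, g) then 1 else (0::complex))"
    if "f \<in> indices" "g \<in> indices" "f' \<in> indices" "g' \<in> indices" for f g f' g'
  proof -
    have "(\<Prod>l\<in>S. if l \<in> S then (if g l = g' l \<and> f l = f' l then 1 else 0)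
             else (if g l = f l \<and> g' l = f' l then 1 else 0)) =
      (\<Prod>l\<in>S. if g l = g' l then 1 else 0) * (\<Prod>l\<in>S. if f l = f' l then 1 else (0::complex))"
      unfolding prod.distrib[symmetric] by (intro prod.cong) auto
    thus ?thesis using prod_delta_funs[OF fin that(4,2)] prod_delta_funs[OF fin that(3,1)] by auto
  qed
  have "purity \<Psi> S = (\<Sum>(f, g)\<in>pairs. \<Sum>q\<in>pairs. if q = (f, g) then \<Psi> f * cnj (\<Psi> f) * (\<Psi> g * cnj (\<Psi> g)) else 0)"
    unfolding purity_def
  proof (rule sum.cong[OF refl], goal_cases)
    case (1 p)
    then obtain f g where p: "p = (f, g)" "f \<in> indices" "g \<in> indices" by auto
    show ?case unfolding p(1) split
    proof (rule sum.cong[OF refl], goal_cases)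
      case (1 q)
      then obtain f' g' where q: "q = (f', g')" "f' \<in> indices" "g' \<in> indices" by auto
      show ?case unfolding q(1) split delta[OF p(2,3) q(2,3)] by (auto simp: mult_ac)
    qed
  qed
  also have "\<dots> = (\<Sum>(f, g)\<in>pairs. \<Psi> f * cnj (\<Psi> f) * (\<Psi> g * cnj (\<Psi> g)))"
    using finite_pairs by (intro sum.cong refl) auto
  also have "\<dots> = (\<Sum>f\<in>indices. \<Psi> f * cnj (\<Psi> f)) * (\<Sum>g\<in>indices. \<Psi> g * cnj (\<Psi> g))"
    by (simp add: sum_product sum.cartesian_product)
  also have "(\<Sum>f\<in>indices. \<Psi> f * cnj (\<Psi> f)) = of_real (\<Sum>f\<in>indices. (cmod (\<Psi> f))\<^sup>2)"
    by (simp only: of_real_sum complex_norm_square)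
  finally show ?thesis using assms by simp
qed

text \<open>A normalized state needs at least one basis index, so no local dimension can
  vanish.\<close>

lemma dim_pos:
  assumes "(\<Sum>f\<in>indices. (cmod (\<Psi> f))\<^sup>2) = 1" "l \<in> S"
  shows "d l > 0"
proof (rule ccontr)
  assume "\<not> d l > 0"
  hence "indices = {}" using assms(2) by (auto simp: PiE_eq_empty_iff)
  thus False using assms(1) by simp
qed

theorem full_sector_weight_bound:
  assumes norm: "(\<Sum>f\<in>indices. (cmod (\<Psi> f))\<^sup>2) = 1" and S0: "S \<noteq> {}"
  shows "(\<Prod>s\<in>S. real (d s) / \<kappa> s) * sector_weight \<Psi> S \<le> mbound d \<kappa> S"
proof -
  let ?c = "sector_weight \<Psi>"
  define D where "D = real (\<Prod>s\<in>S. d s)"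
  define K where "K = (\<Prod>s\<in>S. \<kappa> s)"
  define t where "t = card S"
  define \<Sigma> where "\<Sigma> = (\<Sum>s\<in>S. 1 / (real (d s))\<^sup>2)"
  define P where "P B = Re (purity \<Psi> B)" for B
  note d = dim_pos[OF norm]
  have t1: "t \<ge> 1" using S0 fin by (simp add: t_def Suc_le_eq card_gt_0_iff)
  have D0: "D > 0" unfolding D_def using d by (simp add: prod_pos)
  have K0: "K > 0" unfolding K_def using \<kappa> by (intro prod_pos) force
  have sub: "(\<Sum>A\<in>Pow B. ?c A) = real (\<Prod>l\<in>B. d l) * P B" if "B \<subseteq> S" for B
  proof -
    have "(\<Sum>A\<in>Pow B. ?c A) = Re (of_real (\<Sum>i\<in>closed_sector B. corr_weight \<Psi> i))"
      using sum_sectors[OF that d] by simp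
    also have "\<dots> = Re (of_real (real (\<Prod>l\<in>B. d l)) * purity \<Psi> B)"
      unfolding sum_closed_sector[OF that] of_real_of_nat_eq ..
    finally show ?thesis unfolding P_def by (simp only: Re_complex_of_real mult.commute complex_Re_of_nat) (simp del: of_nat_prod)
  qed
  have PS: "P S = 1" using purity_full[OF norm] by (simp add: P_def)
  \<comment> \<open>The purity of the empty set is that of its complement \<open>S\<close>; this
    also fixes \<open>?c {} = 1\<close>.\<close>
  have P0: "P {} = 1" using purity_complement[of \<Psi> S] PS by (simp add: P_def)
  have c0: "?c {} = 1" using sub[of "{}"] P0 by simp
  have tot: "(\<Sum>A\<in>Pow S. ?c A) = D" using sub[of S] PS by (simp add: D_def)
  have subs: "(\<Sum>A\<in>Pow (S - {s}). ?c A) = D / (real (d s))\<^sup>2 * (1 + ?c {s})" if s: "s \<in> S" for s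
  proof -
    have "(\<Sum>A\<in>Pow {s}. ?c A) = real (d s) * P {s}" using sub[of "{s}"] s by simp
    hence 1: "1 + ?c {s} = real (d s) * P {s}" using c0 by (simp add: Pow_insert)
    \<comment> \<open>The two factors 1 / d_s have different origins: one from removing
      \<open>s\<close> from the product \<open>D\<close>, one from solving fact \<open>1\<close> for
      \<open>P {s}\<close>.\<close>
    have "P (S - {s}) = P {s}" unfolding P_def purity_complement ..
    moreover have "real (\<Prod>l\<in>S - {s}. d l) = D / real (d s)"
      using prod.remove[OF fin s, of d] d[OF s] by (simp add: D_def del: of_nat_prod) 
    ultimately show ?thesis using sub[of "S - {s}"] 1 d[OF s]
      by (simp add: power2_eq_square del: of_nat_prod)
  qed
  have pre: "(\<Prod>s\<in>S. real (d s) / \<kappa> s) = D / K" by (simp add: D_def K_def prod_dividef)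
  have DK: "D / K \<ge> 0" using D0 K0 by simp
  show ?thesis
  proof (cases "t = 1")
    case True
    then obtain s where S: "S = {s}" unfolding t_def by (metis card_1_singletonE)
    \<comment> \<open>With a single party there are only two sectors, so the weight is known
      exactly: \<open>D - 1\<close>.\<close>
    have "Pow S = {{}, S}" using S by auto
    hence cS: "?c S = D - 1" using tot c0 S0 by simp
    have "D = real (d s)" "(\<Prod>s\<in>S. real (d s) / \<kappa> s) = real (d s) / \<kappa> s" by (simp_all add: D_def S)
    hence "(\<Prod>s\<in>S. real (d s) / \<kappa> s) * ?c S = ((real (d s))\<^sup>2 - real (d s)) / \<kappa> s"
      unfolding cS by (simp add: power2_eq_square right_diff_distrib diff_divide_distrib)
    moreover have "mbound d \<kappa> S = ((real (d s))\<^sup>2 - real (d s)) / \<kappa> s" by (simp add: mbound_def S)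
    ultimately show ?thesis by simp
  next
    case False
    hence t2: "card S \<ge> 2" using t1 by (simp add: t_def)
    note bounds = combinatorial_bound[OF fin sector_weight_nonneg c0 tot _ _ subs t2]
    show ?thesis
    proof (cases "t = 2 \<or> (t \<ge> 3 \<and> D / (real (Max (d ` S)))\<^sup>2 < 1)")
      case True
      have mb: "mbound d \<kappa> S = D / K * (D + 1 / (real t - 1) - D / (real t - 1) * \<Sigma>)"
        using True False by (simp only: mbound_def Let_def t_def D_def K_def \<Sigma>_def if_False if_True)
      have "(real t - 1) * ?c S \<le> (real t - 1) * D + 1 - D * \<Sigma>"
        using bounds(1) D0 d by (simp add: t_def \<Sigma>_def)
      hence "?c S \<le> ((real t - 1) * D + 1 - D * \<Sigma>) / (real t - 1)"
        using t2 by (subst pos_le_divide_eq) (auto simp: t_def mult.commute)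
      also have "\<dots> = D + 1 / (real t - 1) - D / (real t - 1) * \<Sigma>"
        using t2 by (subst diff_divide_distrib, subst add_divide_distrib) (auto simp: t_def)
      finally show ?thesis unfolding mb pre by (rule mult_left_mono[OF _ DK])
    next
      case F: False
      hence t3: "card S \<ge> 3" and Dmax: "D / (real (Max (d ` S)))\<^sup>2 \<ge> 1" using t2 by (auto simp: t_def)
      have mb: "mbound d \<kappa> S = D / K * (D + 2 / (real t - 2) - D / (real t - 2) * \<Sigma>)"
        using F False by (simp only: mbound_def Let_def t_def D_def K_def \<Sigma>_def if_False if_True)
      \<comment> \<open>The largest dimension is the worst case, so the condition in
        \<open>mbound\<close> covers every party.\<close>
      have "D / (real (d s))\<^sup>2 \<ge> 1" if s: "s \<in> S" for s
      proof -
        have "real (d s) \<le> real (Max (d ` S))" using s fin by simp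
        hence "D / (real (Max (d ` S)))\<^sup>2 \<le> D / (real (d s))\<^sup>2"
          using D0 d[OF s] by (intro divide_left_mono power_mono) auto
        thus ?thesis using Dmax by linarith
      qed
      hence "(real t - 2) * ?c S \<le> (real t - 2) * D + 2 - D * \<Sigma>"
        using bounds(2) t3 D0 d by (simp add: t_def \<Sigma>_def)
      hence "?c S \<le> ((real t - 2) * D + 2 - D * \<Sigma>) / (real t - 2)"
        using t3 by (subst pos_le_divide_eq) (auto simp: t_def mult.commute)
      also have "\<dots> = D + 2 / (real t - 2) - D / (real t - 2) * \<Sigma>"
        using t3 by (subst diff_divide_distrib, subst add_divide_distrib) (auto simp: t_def)
      finally show ?thesis unfolding mb pre by (rule mult_left_mono[OF _ DK])
    qed
  qed
qed

text \<open>On \<open>sector S\<close> the product of the weights equals the prefactor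
  \<open>?p\<close> of a tensor entry. Squaring the entry produces \<open>?p\<close> twice: one copy
  is the weight in \<open>corr_weight\<close>, the other stays in front of the sum.\<close>

theorem correlation_norm_bound:
  assumes norm: "(\<Sum>f\<in>indices. (cmod (\<Psi> f))\<^sup>2) = 1" and S0: "S \<noteq> {}"
  shows "(\<Sum>i\<in>(\<Pi>\<^sub>E l\<in>S. {1..(d l)\<^sup>2 - 1}).
      (cmod (of_real (\<Prod>s\<in>S. real (d s) / \<kappa> s) * expect d S \<Psi> (\<lambda>l. G l (i l))))\<^sup>2) \<le> mbound d \<kappa> S"
proof -
  let ?p = "\<Prod>s\<in>S. real (d s) / \<kappa> s"
  \<comment> \<open>Positive dimensions make the truncated \<open>(d l)\<^sup>2 - 1\<close> a true
    predecessor.\<close>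
  have eq: "(\<Pi>\<^sub>E l\<in>S. {1..(d l)\<^sup>2 - 1}) = sector S"
    unfolding sector_def using dim_pos[OF norm] by (intro PiE_cong) auto
  have p0: "?p \<ge> 0" by (intro prod_nonneg) (use \<kappa> in \<open>force intro: divide_nonneg_nonneg\<close>)
  have "(\<Sum>i\<in>sector S. (cmod (of_real ?p * expect d S \<Psi> (\<lambda>l. G l (i l))))\<^sup>2) = (\<Sum>i\<in>sector S. ?p * corr_weight \<Psi> i)"
  proof (intro sum.cong refl)
    fix i assume i: "i \<in> sector S"
    have "(\<Prod>l\<in>S. weight l (i l)) = ?p"
      by (intro prod.cong refl) (use i in \<open>force simp: sector_def PiE_iff weight_def\<close>)
    thus "(cmod (of_real ?p * expect d S \<Psi> (\<lambda>l. G l (i l))))\<^sup>2 = ?p * corr_weight \<Psi> i"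
      unfolding corr_weight_def norm_mult norm_of_real using p0
      by (simp only: power_mult_distrib power2_eq_square abs_of_nonneg mult_ac)
  qed
  also have "\<dots> = ?p * sector_weight \<Psi> S" by (simp only: sector_weight_def sum_distrib_left)
  also have "\<dots> \<le> mbound d \<kappa> S" by (rule full_sector_weight_bound[OF norm S0])
  finally show ?thesis unfolding eq .
qed

end

section \<open>Index maps and unfoldings\<close>

text \<open>The value of a \<open>1\<close>-based multi-index as a mixed-radix numeral, most significant digit first;
  the index map \<open>\<iota>\<^sub>n\<close> splices two of them.\<close>
fun radix :: "nat list \<Rightarrow> nat list \<Rightarrow> nat" where
  "radix (D # Ds) (j # js) = (j - 1) * prod_list Ds + radix Ds js"
| "radix _ _ = 0"

lemma multi_indices_Nil [simp]: "multi_indices [] = {[]}"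
  by (auto simp: multi_indices_def)

lemma multi_indices_Cons:
  "multi_indices (D # Ds) = (\<lambda>(j, js). j # js) ` ({1..D} \<times> multi_indices Ds)"
proof (intro equalityI subsetI)
  fix x assume x: "x \<in> multi_indices (D # Ds)"
  then obtain j js where xj: "x = j # js" by (cases x) (auto simp: multi_indices_def)
  have "1 \<le> j \<and> j \<le> D" using x unfolding multi_indices_def xj by (auto dest: spec[of _ 0])
  moreover have "js \<in> multi_indices Ds" using x unfolding multi_indices_def xj
    by (fastforce dest: spec[of _ "Suc _"])
  ultimately show "x \<in> (\<lambda>(j, js). j # js) ` ({1..D} \<times> multi_indices Ds)" unfolding xj by auto
next
  fix x assume "x \<in> (\<lambda>(j, js). j # js) ` ({1..D} \<times> multi_indices Ds)"
  thus "x \<in> multi_indices (D # Ds)" by (auto simp: multi_indices_def nth_Cons split: nat.split)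
qed

lemma finite_card_multi_indices: "finite (multi_indices Ds) \<and> card (multi_indices Ds) = prod_list Ds"
proof (induction Ds)
  case (Cons D Ds)
  have "inj_on (\<lambda>(j, js). j # js) ({1..D} \<times> multi_indices Ds)" by (auto simp: inj_on_def)
  thus ?case using Cons by (simp add: multi_indices_Cons card_image card_cartesian_product)
qed simp

lemma mixed_radix_eq:
  fixes q q' r r' b :: nat
  assumes "r < b" "r' < b" "q * b + r = q' * b + r'"
  shows "q = q'" "r = r'"
proof -
  have "(q * b + r) div b = q" "(q' * b + r') div b = q'" "(q * b + r) mod b = r" "(q' * b + r') mod b = r'"
    using assms(1,2) by auto
  thus "q = q'" "r = r'" using assms(3) by auto
qed

lemma mixed_radix_lt:
  fixes q r a b :: nat
  assumes "q < a" "r < b"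
  shows "q * b + r < a * b"
proof -
  have "q * b + r < (q + 1) * b" using assms by simp
  also have "\<dots> \<le> a * b" using assms by (intro mult_right_mono) auto
  finally show ?thesis .
qed

lemma radix_lt: "js \<in> multi_indices Ds \<Longrightarrow> radix Ds js < prod_list Ds"
proof (induction Ds arbitrary: js)
  case (Cons D Ds)
  then obtain j js' where j: "js = j # js'" "1 \<le> j" "j \<le> D" "js' \<in> multi_indices Ds"
    by (auto simp: multi_indices_Cons)
  thus ?case using mixed_radix_lt[of "j - 1" D] Cons.IH[OF j(4)] by simp
qed simp

lemma inj_on_radix: "inj_on (radix Ds) (multi_indices Ds)"
proof (induction Ds)
  case (Cons D Ds)
  show ?case
  proof (rule inj_onI)
    fix x y assume x: "x \<in> multi_indices (D # Ds)" and y: "y \<in> multi_indices (D # Ds)"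
      and eq: "radix (D # Ds) x = radix (D # Ds) y"
    from x obtain j js where j: "x = j # js" "1 \<le> j" "j \<le> D" "js \<in> multi_indices Ds"
      by (auto simp: multi_indices_Cons)
    from y obtain k ks where k: "y = k # ks" "1 \<le> k" "k \<le> D" "ks \<in> multi_indices Ds"
      by (auto simp: multi_indices_Cons)
    have "j - 1 = k - 1" "radix Ds js = radix Ds ks"
      using mixed_radix_eq[OF radix_lt[OF j(4)] radix_lt[OF k(4)]] eq by (auto simp: j k)
    thus "x = y" using j k Cons inj_onD by fastforce
  qed
qed simp

lemma radix_eq_sum:
  "length js = length Ds \<Longrightarrow>
   radix Ds js = (\<Sum>s<length Ds. (js ! s - 1) * (\<Prod>s'\<in>{Suc s..<length Ds}. Ds ! s'))"
proof (induction Ds arbitrary: js)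
  case (Cons D Ds)
  then obtain j js' where js: "js = j # js'" by (cases js) auto
  have shift: "(\<Prod>s'\<in>{Suc (Suc s)..<Suc (length Ds)}. (D # Ds) ! s') = (\<Prod>s'\<in>{Suc s..<length Ds}. Ds ! s')" for s
    by (subst prod.shift_bounds_Suc_ivl) simp
  have p: "(\<Prod>s'\<in>{Suc 0..<Suc (length Ds)}. (D # Ds) ! s') = prod_list Ds"
    by (subst prod.shift_bounds_Suc_ivl) (simp add: prod.list_conv_set_nth)
  have IH: "radix Ds js' = (\<Sum>s<length Ds. (js' ! s - 1) * (\<Prod>s'\<in>{Suc s..<length Ds}. Ds ! s'))"
    using Cons js by simp
  show ?case unfolding js radix.simps IH list.size(4) add_Suc_right add_0_right sum.lessThan_Suc_shift
    by (simp only: shift p nth_Cons_0 nth_Cons_Suc)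
qed simp

text \<open>Although they come first in the list, the modes 1 to n form the low-order block; the
  numeral of the later modes is scaled by the size of that block. Inside each block the first mode
  is the most significant.\<close>

lemma iota_eq_radix:
  assumes len: "length js = length Ds" and n: "n \<le> length Ds"
  shows "iota n Ds js = radix (drop n Ds) (drop n js) * prod_list (take n Ds) + radix (take n Ds) (take n js) + 1"
proof -
  let ?k = "length Ds"
  have 1: "(\<Prod>s\<in>{1..n}. Ds ! (s - 1)) = prod_list (take n Ds)"
  proof -
    have "(\<Prod>s\<in>{1..n}. Ds ! (s - 1)) = (\<Prod>s\<in>{0..<n}. Ds ! s)"
      by (rule prod.reindex_bij_witness[where i = Suc and j = "\<lambda>s. s - 1"]) auto
    thus ?thesis using n by (simp add: prod.list_conv_set_nth)
  qed
  have 2: "(\<Sum>s'\<in>{1..n}. (js ! (s' - 1) - 1) * (\<Prod>s''\<in>{s'+1..n}. Ds ! (s'' - 1))) = radix (take n Ds) (take n js)"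
  proof -
    have "radix (take n Ds) (take n js) = (\<Sum>s<n. (js ! s - 1) * (\<Prod>s'\<in>{Suc s..<n}. Ds ! s'))"
      by (subst radix_eq_sum) (use len n in \<open>auto intro!: sum.cong prod.cong\<close>)
    also have "\<dots> = (\<Sum>s'\<in>{1..n}. (js ! (s' - 1) - 1) * (\<Prod>s''\<in>{s'+1..n}. Ds ! (s'' - 1)))"
    proof (rule sum.reindex_bij_witness[where j = Suc and i = "\<lambda>s. s - 1"], goal_cases)
      case (5 s)
      have "(\<Prod>s''\<in>{Suc s + 1..n}. Ds ! (s'' - 1)) = (\<Prod>s'\<in>{Suc s..<n}. Ds ! s')"
        by (rule prod.reindex_bij_witness[where i = Suc and j = "\<lambda>s. s - 1"]) auto
      thus ?case by simp
    qed auto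
    finally show ?thesis ..
  qed
  have 3: "(\<Sum>s'\<in>{n+1..?k}. (js ! (s' - 1) - 1) * (\<Prod>s''\<in>{s'+1..?k}. Ds ! (s'' - 1))) = radix (drop n Ds) (drop n js)"
  proof -
    have "radix (drop n Ds) (drop n js) =
        (\<Sum>s<?k - n. (js ! (n + s) - 1) * (\<Prod>s'\<in>{Suc s..<?k - n}. Ds ! (n + s')))"
      by (subst radix_eq_sum) (use len n in \<open>auto intro!: sum.cong prod.cong\<close>)
    also have "\<dots> = (\<Sum>s'\<in>{n+1..?k}. (js ! (s' - 1) - 1) * (\<Prod>s''\<in>{s'+1..?k}. Ds ! (s'' - 1)))"
    proof (rule sum.reindex_bij_witness[where j = "\<lambda>s. n + s + 1" and i = "\<lambda>s. s - n - 1"], goal_cases)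
      case (5 s)
      have "(\<Prod>s''\<in>{n + s + 1 + 1..?k}. Ds ! (s'' - 1)) = (\<Prod>s'\<in>{Suc s..<?k - n}. Ds ! (n + s'))"
        by (rule prod.reindex_bij_witness[where i = "\<lambda>s. n + s + 1" and j = "\<lambda>s. s - n - 1"]) auto
      thus ?case by simp
    qed auto
    finally show ?thesis ..
  qed
  show ?thesis unfolding iota_def Let_def 1 2 3 by (simp add: mult.commute)
qed

lemma take_multi_indices: "js \<in> multi_indices Ds \<Longrightarrow> n \<le> length Ds \<Longrightarrow> take n js \<in> multi_indices (take n Ds)"
  and drop_multi_indices: "js \<in> multi_indices Ds \<Longrightarrow> n \<le> length Ds \<Longrightarrow> drop n js \<in> multi_indices (drop n Ds)"
  by (auto simp: multi_indices_def)

text \<open>Quotient and remainder separate the two blocks, which gives injectivity; surjectivity is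
  by counting. Positions of \<open>iota\<close> start at 1 and those of vectors at 0; the second
  claim guarantees that the truncated subtraction loses nothing.\<close>

theorem bij_betw_iota:
  assumes n: "n \<le> length Ds"
  shows "bij_betw (\<lambda>js. iota n Ds js - 1) (multi_indices Ds) {..<prod_list Ds}"
    and "js \<in> multi_indices Ds \<Longrightarrow> iota n Ds js = Suc (iota n Ds js - 1)"
proof -
  let ?a = "prod_list (take n Ds)" and ?b = "prod_list (drop n Ds)"
  have ab: "prod_list Ds = ?b * ?a"
    using prod_list.append[of "take n Ds" "drop n Ds"] by (simp add: mult.commute)
  have eq: "iota n Ds js = radix (drop n Ds) (drop n js) * ?a + radix (take n Ds) (take n js) + 1"
    if "js \<in> multi_indices Ds" for js
    using iota_eq_radix[OF _ n] that by (simp add: multi_indices_def)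
  have lt: "radix (drop n Ds) (drop n js) < ?b" "radix (take n Ds) (take n js) < ?a"
    if "js \<in> multi_indices Ds" for js
    using radix_lt take_multi_indices[OF that n] drop_multi_indices[OF that n] by auto
  have inj: "inj_on (\<lambda>js. iota n Ds js - 1) (multi_indices Ds)"
  proof (rule inj_onI)
    fix x y assume x: "x \<in> multi_indices Ds" and y: "y \<in> multi_indices Ds"
      and "iota n Ds x - 1 = iota n Ds y - 1"
    hence "radix (drop n Ds) (drop n x) * ?a + radix (take n Ds) (take n x) =
        radix (drop n Ds) (drop n y) * ?a + radix (take n Ds) (take n y)"
      by (simp add: eq)
    note e = mixed_radix_eq[OF lt(2)[OF x] lt(2)[OF y] this]
    have "drop n x = drop n y"
      using inj_onD[OF inj_on_radix e(1)] drop_multi_indices[OF x n] drop_multi_indices[OF y n] by blast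
    moreover have "take n x = take n y"
      using inj_onD[OF inj_on_radix e(2)] take_multi_indices[OF x n] take_multi_indices[OF y n] by blast
    ultimately show "x = y" by (metis append_take_drop_id)
  qed
  have "(\<lambda>js. iota n Ds js - 1) ` multi_indices Ds \<subseteq> {..<prod_list Ds}"
    using mixed_radix_lt lt by (auto simp: eq ab)
  moreover have "card ((\<lambda>js. iota n Ds js - 1) ` multi_indices Ds) = card {..<prod_list Ds}"
    unfolding card_image[OF inj] by (simp add: finite_card_multi_indices)
  ultimately have "(\<lambda>js. iota n Ds js - 1) ` multi_indices Ds = {..<prod_list Ds}"
    by (intro card_subset_eq) auto
  thus "bij_betw (\<lambda>js. iota n Ds js - 1) (multi_indices Ds) {..<prod_list Ds}"
    using inj by (simp add: bij_betw_def)
  show "iota n Ds js = Suc (iota n Ds js - 1)" if "js \<in> multi_indices Ds"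
    using eq[OF that] by simp
qed

lemma bij_betw_multi_indices_PiE:
  assumes "distinct R"
  shows "bij_betw (\<lambda>h. map h R) (\<Pi>\<^sub>E l\<in>set R. {1..D l}) (multi_indices (map D R))"
proof -
  have inj: "inj_on (\<lambda>h. map h R) (\<Pi>\<^sub>E l\<in>set R. {1..D l})"
    by (rule inj_onI) (auto intro: PiE_ext)
  have "(\<lambda>h. map h R) ` (\<Pi>\<^sub>E l\<in>set R. {1..D l}) \<subseteq> multi_indices (map D R)"
    by (fastforce simp: multi_indices_def PiE_iff)
  moreover have "card ((\<lambda>h. map h R) ` (\<Pi>\<^sub>E l\<in>set R. {1..D l})) = card (multi_indices (map D R))"
    unfolding card_image[OF inj] finite_card_multi_indices[THEN conjunct2]
    using assms by (simp add: card_PiE prod.distinct_set_conv_list)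
  ultimately have "(\<lambda>h. map h R) ` (\<Pi>\<^sub>E l\<in>set R. {1..D l}) = multi_indices (map D R)"
    by (intro card_subset_eq) (auto simp: finite_card_multi_indices)
  thus ?thesis using inj by (simp add: bij_betw_def)
qed

text \<open>\<open>h p\<close> is the multi-index stored at position \<open>p\<close>, as a function
  of the party. It resolves the definite descriptions in \<open>vec_n\<close> and
  \<open>mixed_unfold\<close> and turns sums over positions into the sums over product sets of
  \<open>correlation_norm_bound\<close>.\<close>

theorem iota_parametrization:
  assumes "distinct R" "n \<le> length R"
  obtains h where "bij_betw h {..<prod_list (map D R)} (\<Pi>\<^sub>E l\<in>set R. {1..D l})"
    and "\<And>p js. p < prod_list (map D R) \<Longrightarrow> js \<in> multi_indices (map D R) \<Longrightarrow>
      iota n (map D R) js = Suc p \<longleftrightarrow> js = map (h p) R"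
proof -
  let ?P = "\<Pi>\<^sub>E l\<in>set R. {1..D l}" and ?m = "\<lambda>h. map h R" and ?i = "\<lambda>js. iota n (map D R) js - 1"
  have n: "n \<le> length (map D R)" using assms by simp
  note bi = bij_betw_iota(1)[OF n] and bm = bij_betw_multi_indices_PiE[OF assms(1), of D]
  have b: "bij_betw (?i \<circ> ?m) ?P {..<prod_list (map D R)}" by (rule bij_betw_trans[OF bm bi])
  define h where "h = inv_into ?P (?i \<circ> ?m)"
  have hb: "bij_betw h {..<prod_list (map D R)} ?P" unfolding h_def by (rule bij_betw_inv_into[OF b])
  have hi: "?i (map (h p) R) = p" if "p < prod_list (map D R)" for p
    using bij_betw_inv_into_right[OF b, of p] that by (simp add: h_def)
  have hm: "map (h p) R \<in> multi_indices (map D R)" if "p < prod_list (map D R)" for p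
    using bij_betwE[OF bm] bij_betwE[OF hb] that by auto
  have "iota n (map D R) js = Suc p \<longleftrightarrow> js = map (h p) R"
    if p: "p < prod_list (map D R)" and js: "js \<in> multi_indices (map D R)" for p js
  proof
    assume "iota n (map D R) js = Suc p"
    hence "?i js = ?i (map (h p) R)" using hi[OF p] by simp
    thus "js = map (h p) R" using inj_onD[OF bij_betw_imp_inj_on[OF bi]] js hm[OF p] by blast
  next
    assume "js = map (h p) R"
    thus "iota n (map D R) js = Suc p" using bij_betw_iota(2)[OF n js] hi[OF p] by simp
  qed
  thus thesis using that hb by blast
qed

text \<open>The vector \<open>u\<close> on top of the Kronecker product of \<open>\<alpha>\<close>
  with a vector \<open>z\<close> of length \<open>P\<close>, as a plain function of the position;
  these are the rank-one factors x and y of the overview.\<close>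

definition stack :: "real vec \<Rightarrow> real vec \<Rightarrow> nat \<Rightarrow> (nat \<Rightarrow> complex) \<Rightarrow> nat \<Rightarrow> complex" where
  "stack u \<alpha> P z i = (if i < dim_vec u then of_real (u $ i)
     else of_real (\<alpha> $ ((i - dim_vec u) div P)) * z ((i - dim_vec u) mod P))"

lemma sum_lessThan_add:
  fixes f :: "nat \<Rightarrow> 'a :: comm_monoid_add"
  shows "(\<Sum>i<a + b. f i) = (\<Sum>i<a. f i) + (\<Sum>i<b. f (a + i))"
  by (induction b) (simp_all add: add.assoc)

lemma vnorm_sq: "(vnorm u)\<^sup>2 = (\<Sum>i<dim_vec u. (u $ i)\<^sup>2)"
  unfolding vnorm_def by (simp add: sum_nonneg)

lemma stack_norm:
  "(\<Sum>i<dim_vec u + dim_vec \<alpha> * P. (cmod (stack u \<alpha> P z i))\<^sup>2) =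
   (vnorm u)\<^sup>2 + (vnorm \<alpha>)\<^sup>2 * (\<Sum>q<P. (cmod (z q))\<^sup>2)"
proof -
  have "(\<Sum>i<dim_vec \<alpha> * P. (cmod (stack u \<alpha> P z (dim_vec u + i)))\<^sup>2) =
      (\<Sum>i<dim_vec \<alpha> * P. (\<alpha> $ (i div P))\<^sup>2 * (cmod (z (i mod P)))\<^sup>2)"
    by (simp add: stack_def norm_mult power_mult_distrib)
  also have "\<dots> = (\<Sum>i<dim_vec \<alpha>. \<Sum>q<P. (\<alpha> $ i)\<^sup>2 * (cmod (z q))\<^sup>2)"
    by (rule sum_div_mod[where F = "\<lambda>i q. (\<alpha> $ i)\<^sup>2 * (cmod (z q))\<^sup>2"])
  finally show ?thesis
    by (simp add: sum_lessThan_add vnorm_sq sum_product) (simp add: stack_def)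
qed

section \<open>Entries of the vectorized and unfolded tensors\<close>

lemma vec_n_index:
  assumes q: "q < prod_list (map D R)"
    and h: "map h R \<in> multi_indices (map D R)"
      "\<And>js. js \<in> multi_indices (map D R) \<Longrightarrow> iota n (map D R) js = Suc q \<longleftrightarrow> js = map h R"
  shows "vec_n n (map D R) a $ q = a (map h R)"
proof -
  have "(THE js. js \<in> multi_indices (map D R) \<and> iota n (map D R) js = Suc q) = map h R"
    by (rule the_equality) (use h in auto)
  thus ?thesis using q by (simp add: vec_n_def)
qed

lemma nth_map_parties: "l \<in> {1..N} \<Longrightarrow> map f [1..<N+1] ! (l - 1) = f l"
  by (auto simp del: upt_Suc)

lemma map_parties_multi_indices:
  assumes "\<And>l. l \<in> {1..N} \<Longrightarrow> 1 \<le> f l \<and> f l \<le> D l"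
  shows "map f [1..<N+1] \<in> multi_indices (map D [1..<N+1])"
  using assms by (auto simp: multi_indices_def simp del: upt_Suc)

text \<open>The row fixes the indices of the parties in \<open>R\<close>, the column those in
  \<open>C\<close>. As the two lists partition the parties, exactly one full multi-index glues them
  together.\<close>

lemma mixed_unfold_index:
  fixes D :: "nat \<Rightarrow> nat" and N :: nat
  defines "Ds \<equiv> map D [1..<N+1]"
  assumes RC: "set R \<union> set C = {1..N}" "set R \<inter> set C = {}"
    and r: "r < prod_list (map D R)" and c: "c < prod_list (map D C)"
    and h: "map h R \<in> multi_indices (map D R)"
      "\<And>js. js \<in> multi_indices (map D R) \<Longrightarrow> iota n (map D R) js = Suc r \<longleftrightarrow> js = map h R"
    and g: "map g C \<in> multi_indices (map D C)"
      "\<And>js. js \<in> multi_indices (map D C) \<Longrightarrow> iota m (map D C) js = Suc c \<longleftrightarrow> js = map g C"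
  shows "mixed_unfold Ds R n C m a $$ (r, c) = a (map (\<lambda>l. if l \<in> set R then h l else g l) [1..<N+1])"
proof -
  have Ds: "Ds ! (l - 1) = D l" if "l \<in> {1..N}" for l
    unfolding Ds_def by (rule nth_map_parties[OF that])
  have DR: "map (\<lambda>l. Ds ! (l - 1)) R = map D R" and DC: "map (\<lambda>l. Ds ! (l - 1)) C = map D C"
    by (rule map_cong[OF refl], rule Ds, use RC(1) in blast)+
  let ?f = "\<lambda>l. if l \<in> set R then h l else g l"
  let ?js = "map ?f [1..<N+1]"
  have nth: "?js ! (l - 1) = ?f l" if "l \<in> {1..N}" for l
    by (rule nth_map_parties[OF that])
  have jR: "map (\<lambda>l. ?js ! (l - 1)) R = map h R"
  proof (rule map_cong[OF refl])
    fix l assume l: "l \<in> set R"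
    hence "l \<in> {1..N}" using RC(1) by blast
    from nth[OF this] l show "?js ! (l - 1) = h l" by (simp only: if_True)
  qed
  have jC: "map (\<lambda>l. ?js ! (l - 1)) C = map g C"
  proof (rule map_cong[OF refl])
    fix l assume l: "l \<in> set C"
    hence "l \<in> {1..N}" "l \<notin> set R" using RC by blast+
    with nth[OF this(1)] show "?js ! (l - 1) = g l" by (simp only: if_False)
  qed
  have sub: "map (\<lambda>l. js ! (l - 1)) L \<in> multi_indices (map D L)"
    if "js \<in> multi_indices Ds" "set L \<subseteq> {1..N}" for js L
  proof -
    have "1 \<le> js ! (x - 1) \<and> js ! (x - 1) \<le> D x" if "x \<in> {1..N}" for x
    proof -
      have "x - 1 < length Ds" using that by (auto simp: Ds_def simp del: upt_Suc)
      hence "1 \<le> js ! (x - 1) \<and> js ! (x - 1) \<le> Ds ! (x - 1)"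
        using \<open>js \<in> multi_indices Ds\<close> unfolding multi_indices_def by blast
      thus ?thesis using Ds[OF that] by simp
    qed
    moreover have "L ! j \<in> {1..N}" if "j < length L" for j
      using that \<open>set L \<subseteq> {1..N}\<close> nth_mem by blast
    ultimately show ?thesis by (simp add: multi_indices_def)
  qed
  have "(THE js. js \<in> multi_indices Ds \<and> iota n (map D R) (map (\<lambda>l. js ! (l - 1)) R) = Suc r \<and>
      iota m (map D C) (map (\<lambda>l. js ! (l - 1)) C) = Suc c) = ?js"
  proof (rule the_equality)
    have hR: "1 \<le> h l \<and> h l \<le> D l" if "l \<in> set R" for l
      using h(1) that unfolding multi_indices_def by (auto simp: in_set_conv_nth)
    have gC: "1 \<le> g l \<and> g l \<le> D l" if "l \<in> set C" for l
      using g(1) that unfolding multi_indices_def by (auto simp: in_set_conv_nth)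
    have "1 \<le> ?f l \<and> ?f l \<le> D l" if "l \<in> {1..N}" for l
    proof (cases "l \<in> set R")
      case True
      thus ?thesis using hR by simp
    next
      case False
      hence "l \<in> set C" using that RC(1) by blast
      thus ?thesis using gC False by simp
    qed
    hence "?js \<in> multi_indices Ds"
      unfolding Ds_def by (rule map_parties_multi_indices)
    thus "?js \<in> multi_indices Ds \<and> iota n (map D R) (map (\<lambda>l. ?js ! (l - 1)) R) = Suc r \<and>
      iota m (map D C) (map (\<lambda>l. ?js ! (l - 1)) C) = Suc c"
      unfolding jR jC using h g by blast
  next
    fix js assume js: "js \<in> multi_indices Ds \<and> iota n (map D R) (map (\<lambda>l. js ! (l - 1)) R) = Suc r \<and>
      iota m (map D C) (map (\<lambda>l. js ! (l - 1)) C) = Suc c"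
    have "map (\<lambda>l. js ! (l - 1)) R = map h R" "map (\<lambda>l. js ! (l - 1)) C = map g C"
      using js h(2)[OF sub[of js R]] g(2)[OF sub[of js C]] RC(1) by auto
    hence eq: "js ! (x - 1) = ?f x" if "x \<in> {1..N}" for x
      using that RC unfolding map_eq_conv by (cases "x \<in> set R") auto
    show "js = ?js"
    proof (rule nth_equalityI)
      show "length js = length ?js" using js by (simp add: multi_indices_def Ds_def del: upt_Suc)
      fix i assume "i < length js"
      hence "Suc i \<in> {1..N}" using js by (simp add: multi_indices_def Ds_def del: upt_Suc)
      thus "js ! i = ?js ! i" using eq[of "Suc i"] nth[of "Suc i"] by simp
    qed
  qed
  thus ?thesis unfolding mixed_unfold_def Let_def DR DC using r c by simp
qed

text \<open>Replaces the lookup in a zipped list by a case distinction on membership, the form to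
  which \<open>expect_one\<close> and \<open>expect_cong\<close> apply.\<close>

lemma corr_entry_map:
  assumes ss: "set ss \<subseteq> {1..N}"
    and tr: "\<And>X. mtrace (\<rho> * tensor_ops d N X) =
      (\<Sum>i<r. of_real (p i) * (expect d A (\<Psi> i) X * expect d B (\<Phi> i) X))"
  shows "corr_entry d \<kappa> G N \<rho> ss (map h ss) =
    of_real (\<Prod>s\<in>set ss. real (d s) / \<kappa> s) *
    (\<Sum>i<r. of_real (p i) *
      (expect d A (\<Psi> i) (\<lambda>l. if l \<in> set ss then G l (h l) else 1\<^sub>m (d l)) *
       expect d B (\<Phi> i) (\<lambda>l. if l \<in> set ss then G l (h l) else 1\<^sub>m (d l))))"
proof -
  have "(\<lambda>l. case map_of (zip ss (map h ss)) l of Some i \<Rightarrow> G l i | None \<Rightarrow> 1\<^sub>m (d l)) =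
      (\<lambda>l. if l \<in> set ss then G l (h l) else 1\<^sub>m (d l))"
    by (auto simp: map_of_zip_map)
  thus ?thesis unfolding corr_entry_def tr by simp
qed

text \<open>For each term of the mixture a correlation of all parties is a product over the two
  sides, and a correlation of one side alone picks up the factor 1 from the other. So the same
  numbers \<open>x\<close> and \<open>y\<close> fill all the blocks.\<close>

theorem trace_norm_Mmat_le:
  fixes u v \<alpha> \<beta> :: "real vec"
  assumes RC: "set R \<union> set C = {1..N}" "set R \<inter> set C = {}" "distinct R" "distinct C"
    and ne: "R \<noteq> []" "C \<noteq> []" and n: "n \<le> length R" and m: "m \<le> length C"
    and basesR: "operator_bases d \<kappa> G (set R)" and basesC: "operator_bases d \<kappa> G (set C)"
    and bisep: "biseparable d N (set R) \<rho>"
  shows "trace_norm (Mmat d \<kappa> G N R C n m u v \<alpha> \<beta> \<rho>)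
         \<le> sqrt ((vnorm u)\<^sup>2 + (vnorm \<alpha>)\<^sup>2 * mbound d \<kappa> (set R))
           * sqrt ((vnorm v)\<^sup>2 + (vnorm \<beta>)\<^sup>2 * mbound d \<kappa> (set C))"
proof -
  have C: "{1..N} - set R = set C" and Rsub: "set R \<subseteq> {1..N}" and Csub: "set C \<subseteq> {1..N}" using RC by auto
  obtain r :: nat and p :: "nat \<Rightarrow> real" and \<Psi> \<Phi> where p0: "\<And>i. i < r \<Longrightarrow> p i \<ge> 0" and p1: "(\<Sum>i<r. p i) = 1"
    and \<Psi>: "\<And>i. i < r \<Longrightarrow> (\<Sum>f\<in>local_indices d (set R). (cmod (\<Psi> i f))\<^sup>2) = 1"
    and \<Phi>: "\<And>i. i < r \<Longrightarrow> (\<Sum>f\<in>local_indices d (set C). (cmod (\<Phi> i f))\<^sup>2) = 1"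
    and tr: "\<And>X. mtrace (\<rho> * tensor_ops d N X) =
      (\<Sum>i<r. of_real (p i) * (expect d (set R) (\<Psi> i) X * expect d (set C) (\<Phi> i) X))"
    using biseparable_expectations[OF bisep Rsub] unfolding C by blast
  define D where "D l = (d l)\<^sup>2 - 1" for l
  have ms: "mode_sizes d L = map D L" for L by (simp add: mode_sizes_def D_def)
  let ?PR = "prod_list (map D R)" and ?PC = "prod_list (map D C)"
  obtain h where hb: "bij_betw h {..<?PR} (\<Pi>\<^sub>E l\<in>set R. {1..D l})"
    and hi: "\<And>p js. p < ?PR \<Longrightarrow> js \<in> multi_indices (map D R) \<Longrightarrow>
      iota n (map D R) js = Suc p \<longleftrightarrow> js = map (h p) R"
    using iota_parametrization[OF RC(3) n] by blast
  obtain g where gb: "bij_betw g {..<?PC} (\<Pi>\<^sub>E l\<in>set C. {1..D l})"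
    and gi: "\<And>p js. p < ?PC \<Longrightarrow> js \<in> multi_indices (map D C) \<Longrightarrow>
      iota m (map D C) js = Suc p \<longleftrightarrow> js = map (g p) C"
    using iota_parametrization[OF RC(4) m] by blast
  have hm: "map (h q) R \<in> multi_indices (map D R)" if "q < ?PR" for q
    using bij_betwE[OF bij_betw_multi_indices_PiE[OF RC(3)]] bij_betwE[OF hb] that by auto
  have gm: "map (g q) C \<in> multi_indices (map D C)" if "q < ?PC" for q
    using bij_betwE[OF bij_betw_multi_indices_PiE[OF RC(4)]] bij_betwE[OF gb] that by auto
  define cR where "cR = complex_of_real (\<Prod>s\<in>set R. real (d s) / \<kappa> s)"
  define cC where "cC = complex_of_real (\<Prod>s\<in>set C. real (d s) / \<kappa> s)"
  define x where "x i q = cR * expect d (set R) (\<Psi> i) (\<lambda>l. G l (h q l))" for i q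
  define y where "y i q = cC * expect d (set C) (\<Phi> i) (\<lambda>l. G l (g q l))" for i q
  define vR where "vR = vec_n n (mode_sizes d R) (corr_entry d \<kappa> G N \<rho> R)"
  define vC where "vC = vec_n m (mode_sizes d C) (corr_entry d \<kappa> G N \<rho> C)"
  define TU where "TU = mixed_unfold (mode_sizes d [1..<N+1]) R n C m (corr_entry d \<kappa> G N \<rho> [1..<N+1])"
  have vR: "vR $ q = (\<Sum>i<r. of_real (p i) * x i q)" if q: "q < ?PR" for q
  proof -
    let ?X = "\<lambda>l. if l \<in> set R then G l (h q l) else 1\<^sub>m (d l)"
    have "vR $ q = corr_entry d \<kappa> G N \<rho> R (map (h q) R)"
      unfolding vR_def ms using vec_n_index[OF q hm[OF q] hi[OF q]] .
    also have "\<dots> = cR * (\<Sum>i<r. of_real (p i) * (expect d (set R) (\<Psi> i) ?X * expect d (set C) (\<Phi> i) ?X))"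
      unfolding cR_def by (rule corr_entry_map[OF Rsub tr])
    also have "\<dots> = (\<Sum>i<r. of_real (p i) * x i q)"
      unfolding sum_distrib_left
    proof (intro sum.cong refl)
      fix i assume "i \<in> {..<r}"
      hence "expect d (set C) (\<Phi> i) ?X = 1" using RC(2) by (intro expect_one) (auto simp: \<Phi>)
      moreover have "expect d (set R) (\<Psi> i) ?X = expect d (set R) (\<Psi> i) (\<lambda>l. G l (h q l))"
        by (rule expect_cong) auto
      ultimately show "cR * (of_real (p i) * (expect d (set R) (\<Psi> i) ?X * expect d (set C) (\<Phi> i) ?X)) =
          of_real (p i) * x i q" by (simp add: x_def)
    qed
    finally show ?thesis .
  qed
  have vC: "vC $ q = (\<Sum>i<r. of_real (p i) * y i q)" if q: "q < ?PC" for q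
  proof -
    let ?X = "\<lambda>l. if l \<in> set C then G l (g q l) else 1\<^sub>m (d l)"
    have "vC $ q = corr_entry d \<kappa> G N \<rho> C (map (g q) C)"
      unfolding vC_def ms using vec_n_index[OF q gm[OF q] gi[OF q]] .
    also have "\<dots> = cC * (\<Sum>i<r. of_real (p i) * (expect d (set R) (\<Psi> i) ?X * expect d (set C) (\<Phi> i) ?X))"
      unfolding cC_def by (rule corr_entry_map[OF Csub tr])
    also have "\<dots> = (\<Sum>i<r. of_real (p i) * y i q)"
      unfolding sum_distrib_left
    proof (intro sum.cong refl)
      fix i assume "i \<in> {..<r}"
      hence "expect d (set R) (\<Psi> i) ?X = 1" using RC(2) by (intro expect_one) (auto simp: \<Psi>)
      moreover have "expect d (set C) (\<Phi> i) ?X = expect d (set C) (\<Phi> i) (\<lambda>l. G l (g q l))"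
        by (rule expect_cong) auto
      ultimately show "cC * (of_real (p i) * (expect d (set R) (\<Psi> i) ?X * expect d (set C) (\<Phi> i) ?X)) =
          of_real (p i) * y i q" by (simp add: y_def)
    qed
    finally show ?thesis .
  qed
  have TU: "TU $$ (q, q') = (\<Sum>i<r. of_real (p i) * (x i q * y i q'))" if q: "q < ?PR" and q': "q' < ?PC" for q q'
  proof -
    let ?f = "\<lambda>l. if l \<in> set R then h q l else g q' l"
    have sN: "set [1..<N+1] = {1..N}" by auto
    let ?X = "\<lambda>l. if l \<in> set [1..<N+1] then G l (?f l) else 1\<^sub>m (d l)"
    have "TU $$ (q, q') = corr_entry d \<kappa> G N \<rho> [1..<N+1] (map ?f [1..<N+1])"
      unfolding TU_def ms using mixed_unfold_index[OF RC(1,2) q q' hm[OF q] hi[OF q] gm[OF q'] gi[OF q']] .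
    also have "\<dots> = of_real (\<Prod>s\<in>set [1..<N+1]. real (d s) / \<kappa> s) *
        (\<Sum>i<r. of_real (p i) * (expect d (set R) (\<Psi> i) ?X * expect d (set C) (\<Phi> i) ?X))"
      by (rule corr_entry_map[OF _ tr]) auto
    also have "complex_of_real (\<Prod>s\<in>set [1..<N+1]. real (d s) / \<kappa> s) = cR * cC"
      unfolding sN RC(1)[symmetric] cR_def cC_def using RC(2) by (subst prod.union_disjoint) auto
    also have "cR * cC * (\<Sum>i<r. of_real (p i) * (expect d (set R) (\<Psi> i) ?X * expect d (set C) (\<Phi> i) ?X)) =
        (\<Sum>i<r. of_real (p i) * (x i q * y i q'))"
      unfolding sum_distrib_left
    proof (intro sum.cong refl)
      fix i
      have "expect d (set R) (\<Psi> i) ?X = expect d (set R) (\<Psi> i) (\<lambda>l. G l (h q l))"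
        by (rule expect_cong) (use Rsub in auto)
      moreover have "expect d (set C) (\<Phi> i) ?X = expect d (set C) (\<Phi> i) (\<lambda>l. G l (g q' l))"
        by (rule expect_cong) (use Csub RC(2) in auto)
      ultimately show "cR * cC * (of_real (p i) * (expect d (set R) (\<Psi> i) ?X * expect d (set C) (\<Phi> i) ?X)) =
          of_real (p i) * (x i q * y i q')" by (simp only: x_def y_def mult_ac)
    qed
    finally show ?thesis .
  qed
  have dR: "dim_vec vR = ?PR" and dC: "dim_vec vC = ?PC" by (simp_all add: vR_def vC_def ms vec_n_def)
  have dT: "dim_row TU = ?PR" "dim_col TU = ?PC"
  proof -
    have sub: "map (\<lambda>l. map D [1..<N+1] ! (l - 1)) L = map D L" if "set L \<subseteq> {1..N}" for L
      by (rule map_cong[OF refl], rule nth_map_parties) (use that in blast)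
    show "dim_row TU = ?PR" "dim_col TU = ?PC"
      unfolding TU_def ms mixed_unfold_def Let_def sub[OF Rsub] sub[OF Csub] by simp_all
  qed
  let ?M = "Mmat d \<kappa> G N R C n m u v \<alpha> \<beta> \<rho>"
  let ?a = "dim_vec u + dim_vec \<alpha> * ?PR" and ?b = "dim_vec v + dim_vec \<beta> * ?PC"
  have M: "?M = four_block_mat (outer (cvec u) (cvec v)) (outer (cvec u) (kron_vec (cvec \<beta>) vC))
           (outer (kron_vec (cvec \<alpha>) vR) (cvec v)) (kron (outer (cvec \<alpha>) (cvec \<beta>)) TU)"
    by (simp only: Mmat_def Let_def vR_def vC_def TU_def)
  have Mc: "?M \<in> carrier_mat ?a ?b"
    unfolding M by (rule carrier_matI) (simp_all add: outer_def kron_def cvec_def dT)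
  have p1': "(\<Sum>i<r. complex_of_real (p i)) = 1" using p1 by (simp flip: of_real_sum)
  \<comment> \<open>A position below \<open>q * P\<close> exists only if \<open>P\<close> is
    nonzero, so the remainder is a valid position even though the tensors may be empty.\<close>
  have dm: "j div P < q" "j mod P < P" if "j < q * P" for j P q :: nat
    using that by (auto simp: less_mult_imp_div_less) (cases "P = 0"; simp)
  have ent: "?M $$ (i, j) = (\<Sum>k<r. of_real (p k) * stack u \<alpha> ?PR (x k) i * stack v \<beta> ?PC (y k) j)"
    if i: "i < ?a" and j: "j < ?b" for i j
  proof -
    let ?i = "i - dim_vec u" and ?j = "j - dim_vec v"
    have ii: "?i < dim_vec \<alpha> * ?PR" if "\<not> i < dim_vec u" using that i by simp
    have jj: "?j < dim_vec \<beta> * ?PC" if "\<not> j < dim_vec v" using that j by simp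
    consider "i < dim_vec u" "j < dim_vec v" | "i < dim_vec u" "\<not> j < dim_vec v"
      | "\<not> i < dim_vec u" "j < dim_vec v" | "\<not> i < dim_vec u" "\<not> j < dim_vec v" by blast
    thus ?thesis
    proof cases
      case 1
      have "?M $$ (i, j) = of_real (u $ i) * of_real (v $ j)"
        unfolding M using 1 i j dT by (simp add: outer_def kron_def cvec_def)
      \<comment> \<open>The corner does not depend on the state; it is spread over the terms of the
        mixture because the probabilities sum to 1.\<close>
      also have "\<dots> = (\<Sum>k<r. of_real (p k)) * (of_real (u $ i) * of_real (v $ j))" by (simp add: p1')
      finally show ?thesis using 1 by (simp add: stack_def sum_distrib_right mult.assoc)
    next
      case 2
      note jd = dm[OF jj[OF 2(2)]]
      have "?M $$ (i, j) = of_real (u $ i) * (of_real (\<beta> $ (?j div ?PC)) * vC $ (?j mod ?PC))"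
        unfolding M using 2 i j dT jj[OF 2(2)] jd by (simp add: outer_def kron_def kron_vec_def cvec_def dC)
      thus ?thesis using 2 jd by (simp add: vC stack_def sum_distrib_left mult_ac)
    next
      case 3
      note id = dm[OF ii[OF 3(1)]]
      have "?M $$ (i, j) = of_real (\<alpha> $ (?i div ?PR)) * vR $ (?i mod ?PR) * of_real (v $ j)"
        unfolding M using 3 i j dT ii[OF 3(1)] id by (simp add: outer_def kron_def kron_vec_def cvec_def dR)
      thus ?thesis using 3 id by (simp add: vR stack_def sum_distrib_left sum_distrib_right mult_ac)
    next
      case 4
      note id = dm[OF ii[OF 4(1)]] and jd = dm[OF jj[OF 4(2)]]
      have "?M $$ (i, j) = of_real (\<alpha> $ (?i div ?PR)) * of_real (\<beta> $ (?j div ?PC)) * TU $$ (?i mod ?PR, ?j mod ?PC)"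
        unfolding M using 4 i j dT ii[OF 4(1)] jj[OF 4(2)] id jd
        by (simp add: outer_def kron_def kron_vec_def cvec_def)
      thus ?thesis using 4 id jd by (simp add: TU stack_def sum_distrib_left mult_ac)
    qed
  qed
  have xn: "(\<Sum>q<?PR. (cmod (x i q))\<^sup>2) \<le> mbound d \<kappa> (set R)" if "i < r" for i
  proof -
    have "(\<Sum>q<?PR. (cmod (x i q))\<^sup>2) =
        (\<Sum>f\<in>(\<Pi>\<^sub>E l\<in>set R. {1..D l}). (cmod (cR * expect d (set R) (\<Psi> i) (\<lambda>l. G l (f l))))\<^sup>2)"
      unfolding x_def by (rule sum.reindex_bij_betw[OF hb])
    thus ?thesis using operator_bases.correlation_norm_bound[OF basesR \<Psi>[OF that]] ne(1)
      by (simp add: D_def cR_def)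
  qed
  have yn: "(\<Sum>q<?PC. (cmod (y i q))\<^sup>2) \<le> mbound d \<kappa> (set C)" if "i < r" for i
  proof -
    have "(\<Sum>q<?PC. (cmod (y i q))\<^sup>2) =
        (\<Sum>f\<in>(\<Pi>\<^sub>E l\<in>set C. {1..D l}). (cmod (cC * expect d (set C) (\<Phi> i) (\<lambda>l. G l (f l))))\<^sup>2)"
      unfolding y_def by (rule sum.reindex_bij_betw[OF gb])
    thus ?thesis using operator_bases.correlation_norm_bound[OF basesC \<Phi>[OF that]] ne(2)
      by (simp add: D_def cC_def)
  qed
  let ?U = "sqrt ((vnorm u)\<^sup>2 + (vnorm \<alpha>)\<^sup>2 * mbound d \<kappa> (set R))"
  let ?V = "sqrt ((vnorm v)\<^sup>2 + (vnorm \<beta>)\<^sup>2 * mbound d \<kappa> (set C))"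
  have "trace_norm ?M \<le> (\<Sum>k<r. p k * (sqrt (\<Sum>i<?a. (cmod (stack u \<alpha> ?PR (x k) i))\<^sup>2) *
      sqrt (\<Sum>j<?b. (cmod (stack v \<beta> ?PC (y k) j))\<^sup>2)))"
    by (rule trace_norm_rank_one_sum_le[OF Mc ent p0])
  also have "\<dots> \<le> (\<Sum>k<r. p k * (?U * ?V))"
  proof (intro sum_mono mult_left_mono)
    fix k assume "k \<in> {..<r}"
    hence k: "k < r" by simp
    have "sqrt (\<Sum>i<?a. (cmod (stack u \<alpha> ?PR (x k) i))\<^sup>2) \<le> ?U"
      unfolding stack_norm using xn[OF k] by (simp add: mult_left_mono)
    moreover have "sqrt (\<Sum>j<?b. (cmod (stack v \<beta> ?PC (y k) j))\<^sup>2) \<le> ?V"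
      unfolding stack_norm using yn[OF k] by (simp add: mult_left_mono)
    ultimately show "sqrt (\<Sum>i<?a. (cmod (stack u \<alpha> ?PR (x k) i))\<^sup>2) *
        sqrt (\<Sum>j<?b. (cmod (stack v \<beta> ?PC (y k) j))\<^sup>2) \<le> ?U * ?V"
      by (rule mult_mono'[rotated 2, rotated 2]) (simp_all add: sum_nonneg)
    show "0 \<le> p k" using p0[OF k] .
  qed
  also have "\<dots> = ?U * ?V" by (simp add: sum_distrib_right[symmetric] p1)
  finally show ?thesis .
qed

theorem theorem4:
  fixes N k n m :: nat
    and d :: "nat \<Rightarrow> nat" and \<kappa> :: "nat \<Rightarrow> real"
    and G :: "nat \<Rightarrow> nat \<Rightarrow> complex mat"
    and l :: "nat \<Rightarrow> nat"
    and u v \<alpha> \<beta> :: "real vec"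
    and \<rho> :: "complex mat"
  assumes N: "N \<ge> 2"
    and G_dim: "\<And>s i. s \<in> {1..N} \<Longrightarrow> i < (d s)\<^sup>2 \<Longrightarrow> G s i \<in> carrier_mat (d s) (d s)"
    and G_0: "\<And>s. s \<in> {1..N} \<Longrightarrow> G s 0 = 1\<^sub>m (d s)"
    and G_tr: "\<And>s i. s \<in> {1..N} \<Longrightarrow> 1 \<le> i \<Longrightarrow> i < (d s)\<^sup>2 \<Longrightarrow> mtrace (G s i) = 0"
    and G_orth: "\<And>s i i'. s \<in> {1..N} \<Longrightarrow> 1 \<le> i \<Longrightarrow> i < (d s)\<^sup>2 \<Longrightarrow> 1 \<le> i' \<Longrightarrow> i' < (d s)\<^sup>2 \<Longrightarrow>
                  mtrace (mat_adjoint (G s i) * G s i') = (if i = i' then complex_of_real (\<kappa> s) else 0)"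
    and \<kappa>: "\<And>s. s \<in> {1..N} \<Longrightarrow> \<kappa> s \<ge> 1"
    and k: "1 \<le> k" "k \<le> N - 1"
    and l_perm: "bij_betw l {1..N} {1..N}"
    and l_R: "\<And>i j. 1 \<le> i \<Longrightarrow> i < j \<Longrightarrow> j \<le> k \<Longrightarrow> l i < l j"
    and l_C: "\<And>i j. k + 1 \<le> i \<Longrightarrow> i < j \<Longrightarrow> j \<le> N \<Longrightarrow> l i < l j"
    and l_1: "l 1 < l (k + 1)"
    and n: "1 \<le> n" "n \<le> k"
    and m: "1 \<le> m" "m \<le> N - k"
    and dims: "dim_vec u > 0" "dim_vec v > 0" "dim_vec \<alpha> > 0" "dim_vec \<beta> > 0"
    and bisep: "biseparable d N (l ` {1..k}) \<rho>"
  shows "trace_norm (Mmat d \<kappa> G N (map l [1..<k+1]) (map l [k+1..<N+1]) n m u v \<alpha> \<beta> \<rho>)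
         \<le> sqrt ((vnorm u)\<^sup>2 + (vnorm \<alpha>)\<^sup>2 * mbound d \<kappa> (l ` {1..k}))
           * sqrt ((vnorm v)\<^sup>2 + (vnorm \<beta>)\<^sup>2 * mbound d \<kappa> (l ` {k+1..N}))"
proof -
  let ?R = "map l [1..<k+1]" and ?C = "map l [k+1..<N+1]"
  have inj: "inj_on l {1..N}" and img: "l ` {1..N} = {1..N}" using l_perm by (auto simp: bij_betw_def)
  have un: "{1..N} = {1..k} \<union> {k+1..N}" using k by auto
  have sR: "set ?R = l ` {1..k}" and sC: "set ?C = l ` {k+1..N}" by auto
  \<comment> \<open>Disjoint ranges of positions become disjoint groups of parties because
    \<open>l\<close> is injective.\<close>
  have "l ` {1..k} \<inter> l ` {k+1..N} = l ` ({1..k} \<inter> {k+1..N})"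
    by (rule inj_on_image_Int[OF inj, symmetric]) (use k in auto)
  hence disj: "set ?R \<inter> set ?C = {}" unfolding sR sC by simp
  have union: "set ?R \<union> set ?C = {1..N}" unfolding sR sC image_Un[symmetric] un[symmetric] by (rule img)
  have dist: "distinct ?R" "distinct ?C"
    unfolding distinct_map using k by (auto intro!: inj_on_subset[OF inj] simp del: upt_Suc)
  have bases: "operator_bases d \<kappa> G S" if "finite S" "S \<subseteq> {1..N}" for S
  proof
    show "mtrace (mat_adjoint (G s i) * G s i') = (if i = i' then complex_of_real (\<kappa> s) else 0)"
      if "s \<in> S" "1 \<le> i" "i < (d s)\<^sup>2" "1 \<le> i'" "i' < (d s)\<^sup>2" for s i i'
      using G_orth[of s i i'] that \<open>S \<subseteq> {1..N}\<close> by blast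
  qed (use that G_dim G_0 G_tr \<kappa> in blast)+
  have sub: "set ?R \<subseteq> {1..N}" "set ?C \<subseteq> {1..N}" using union by blast+
  have ne: "?R \<noteq> []" "?C \<noteq> []" using k N by auto
  have len: "n \<le> length ?R" "m \<le> length ?C" using n m k N by (auto simp del: upt_Suc)
  have bisep': "biseparable d N (set ?R) \<rho>" using bisep unfolding sR .
  show ?thesis
    using trace_norm_Mmat_le[OF union disj dist ne len bases[OF _ sub(1)] bases[OF _ sub(2)] bisep']
    unfolding sR sC by (simp only: finite_imageI finite_atLeastAtMost)
qed

end
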